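(* Let $\omega\in\Omega^{n+1}(M)$ be a pre-$n$-plectic form on a manifold $M$. Consider the graded vector space $C$ whose non-trivial components are $$C_2=\langle\omega\rangle,\quad C_1=\Omega^n(M),\quad C_0=\Omega^{n-1}_{\mathrm{Ham}}(M),\quad C_i=\Omega^{n-1+i}(M)\ \text{ for }1-n\le i\le-1,$$ where $\langle\omega\rangle$ denotes the one-dimensional real vector space generated by $\omega$. Define multilinear maps $[\cdots]_k$ on $C^{\otimes k}$ as follows: (i) for $k\ge0$ and $\alpha_1,\dots,\alpha_k$ of degree zero, $[\alpha_1,\dots,\alpha_k]_k=\varsigma(k)\,\iota(v_{\alpha_1}\wedge\dots\wedge v_{\alpha_k})\omega$; (ii) for $k\ge2$ and $\alpha_1,\dots,\alpha_k$ of degree zero, $[\alpha_1,\dots,\alpha_i,-\omega,\alpha_{i+1},\dots,\alpha_k]_{k+1}=(-1)^i\,d[\alpha_1,\dots,\alpha_k]_k$, where $d$ is the de Rham differential; and all other multibrackets are declared to vanish. Then $C$, together with this collection of multibrackets, is a curved $L_\infty$-algebra.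
   Context: A pre-$n$-plectic form on $M$ is a closed $(n+1)$-form $\omega$. An $(n-1)$-form $\alpha$ is Hamiltonian (written $\alpha\in\Omega^{n-1}_{\mathrm{Ham}}(M)$) if there is a vector field $v_\alpha$ with $d\alpha=-\iota_{v_\alpha}\omega$; $v_\alpha$ denotes any such vector field (a Hamiltonian vector field of $\alpha$). Convention: $\iota(v_1\wedge\dots\wedge v_k)=\iota_{v_k}\cdots\iota_{v_1}$; for $k=0$ the contraction is $\omega$ itself. $\varsigma(k):=-(-1)^{k(k+1)/2}$; so the zero-th bracket is $[1]_0=-\omega$. A curved $L_\infty$-algebra is a $\mathbb Z$-graded vector space $W$ with linear maps $l_k:\otimes^kW\to W$ ($k\ge0$) of degree $2-k$, graded antisymmetric, satisfying for every $m\ge0$ and all homogeneous $w_1,\dots,w_m\in W$ $$\sum_{\substack{i+j=m+1\\i\ge0,\,j\ge1}}(-1)^{i(j-1)}\sum_{\sigma\in Sh_{i,m-i}}(-1)^\sigma\epsilon(\sigma)\,l_j\big(l_i(w_{\sigma(1)},\dots,w_{\sigma(i)}),w_{\sigma(i+1)},\dots,w_{\sigma(m)}\big)=0,$$ where $Sh_{i,m-i}$ is the set of $(i,m-i)$-unshuffles (permutations with $\sigma(1)<\dots<\sigma(i)$ and $\sigma(i+1)<\dots<\sigma(m)$), $(-1)^\sigma$ is the sign of $\sigma$ and $\epsilon(\sigma)$ is the Koszul sign (depending on the $w_i$). *)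

theory Defs
  imports
    "HOL-Analysis.Analysis"
    "HOL-Combinatorics.Permutations"
    "HOL-Library.Function_Algebras"
begin

section \<open>Real vector space structure on function types\<close>

instantiation "fun" :: (type, real_vector) real_vector
begin

definition scaleR_fun :: "real \<Rightarrow> ('a \<Rightarrow> 'b) \<Rightarrow> 'a \<Rightarrow> 'b" where
  "scaleR_fun r f = (\<lambda>x. r *\<^sub>R f x)"

instance
  by standard
    (simp_all add: scaleR_fun_def plus_fun_def fun_eq_iff scaleR_add_right scaleR_add_left)

end

section \<open>Smooth manifolds\<close>

text \<open>
  The model space is \<^term>\<open>Euclidean_space m\<close>, the space of sequences vanishing from index
  \<open>m\<close> on, so that the dimension is a natural number (\<open>m = 0\<close> included).
  A function is \<open>C\<^sup>k\<close> on an open set if all its iterated partial derivatives of order at most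
  \<open>k\<close> exist and are continuous there.
\<close>

definition partial_deriv :: "nat \<Rightarrow> ((nat \<Rightarrow> real) \<Rightarrow> real) \<Rightarrow> (nat \<Rightarrow> real) \<Rightarrow> real" where
  "partial_deriv i f x = deriv (\<lambda>t. f (x(i := t))) (x i)"

primrec C_k_on :: "nat \<Rightarrow> (nat \<Rightarrow> real) set \<Rightarrow> nat \<Rightarrow> ((nat \<Rightarrow> real) \<Rightarrow> real) \<Rightarrow> bool" where
  "C_k_on m V 0 f \<longleftrightarrow> continuous_map (subtopology (Euclidean_space m) V) euclideanreal f"
| "C_k_on m V (Suc k) f \<longleftrightarrow>
     continuous_map (subtopology (Euclidean_space m) V) euclideanreal f \<and>
     (\<forall>i<m. (\<forall>x\<in>V. (\<lambda>t. f (x(i := t))) field_differentiable at (x i)) \<and>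
            C_k_on m V k (partial_deriv i f))"

definition smooth_on :: "nat \<Rightarrow> (nat \<Rightarrow> real) set \<Rightarrow> ((nat \<Rightarrow> real) \<Rightarrow> real) \<Rightarrow> bool" where
  "smooth_on m V f \<longleftrightarrow> (\<forall>k. C_k_on m V k f)"

text \<open>
  The underlying set of a manifold is the whole type \<open>'a\<close>, its topology is the one given by the
  type class. The atlas need not be maximal.
\<close>

record 'a manifold =
  mdim :: nat
  atlas :: "('a set \<times> ('a \<Rightarrow> nat \<Rightarrow> real)) set"

definition is_chart :: "nat \<Rightarrow> 'a::topological_space set \<Rightarrow> ('a \<Rightarrow> nat \<Rightarrow> real) \<Rightarrow> bool" where
  "is_chart m U \<phi> \<longleftrightarrow> open U \<and> openin (Euclidean_space m) (\<phi> ` U) \<and>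
     homeomorphic_map (top_of_set U) (subtopology (Euclidean_space m) (\<phi> ` U)) \<phi>"

definition smooth_manifold ::
    "'a::{t2_space, second_countable_topology} manifold \<Rightarrow> bool" where
  "smooth_manifold M \<longleftrightarrow>
     (\<forall>(U, \<phi>)\<in>atlas M. is_chart (mdim M) U \<phi>) \<and>
     (\<Union>(U, \<phi>)\<in>atlas M. U) = UNIV \<and>
     (\<forall>(U, \<phi>)\<in>atlas M. \<forall>(V, \<psi>)\<in>atlas M. \<forall>i<mdim M.
        smooth_on (mdim M) (\<phi> ` (U \<inter> V)) (\<lambda>y. \<psi> (inv_into U \<phi> y) i))"

definition smooth_functions :: "'a manifold \<Rightarrow> ('a \<Rightarrow> real) set" where
  "smooth_functions M =
     {f. \<forall>(U, \<phi>)\<in>atlas M. smooth_on (mdim M) (\<phi> ` U) (\<lambda>y. f (inv_into U \<phi> y))}"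

section \<open>Vector fields and differential forms\<close>

text \<open>
  Vector fields are the derivations of the algebra of smooth functions, and differential
  \<open>k\<close>-forms are the alternating \<open>k\<close>-linear maps, over smooth functions, from vector fields to
  smooth functions. A form is a function of the list of its arguments. Outside their domains
  vector fields and forms are set to zero, so that equality is equality of functions.
\<close>

type_synonym 'a vfield = "('a \<Rightarrow> real) \<Rightarrow> 'a \<Rightarrow> real"

type_synonym 'a dform = "'a vfield list \<Rightarrow> 'a \<Rightarrow> real"

definition vector_fields :: "'a manifold \<Rightarrow> 'a vfield set" where
  "vector_fields M = {X.
     (\<forall>f\<in>smooth_functions M. X f \<in> smooth_functions M) \<and>
     (\<forall>f\<in>smooth_functions M. \<forall>g\<in>smooth_functions M. X (f + g) = X f + X g) \<and>
     (\<forall>f\<in>smooth_functions M. \<forall>c. X (c *\<^sub>R f) = c *\<^sub>R X f) \<and>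
     (\<forall>f\<in>smooth_functions M. \<forall>g\<in>smooth_functions M. X (f * g) = f * X g + g * X f) \<and>
     (\<forall>f. f \<notin> smooth_functions M \<longrightarrow> X f = 0)}"

definition lie_bracket :: "'a vfield \<Rightarrow> 'a vfield \<Rightarrow> 'a vfield" where
  "lie_bracket X Y = (\<lambda>f. X (Y f) - Y (X f))"

definition forms :: "'a manifold \<Rightarrow> nat \<Rightarrow> 'a dform set" where
  "forms M k = {\<alpha>.
     (\<forall>Xs. length Xs = k \<and> set Xs \<subseteq> vector_fields M \<longrightarrow>
        \<alpha> Xs \<in> smooth_functions M \<and>
        (\<forall>i<k. \<forall>X\<in>vector_fields M. \<forall>Y\<in>vector_fields M.
           \<alpha> (Xs[i := X + Y]) = \<alpha> (Xs[i := X]) + \<alpha> (Xs[i := Y])) \<and>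
        (\<forall>i<k. \<forall>X\<in>vector_fields M. \<forall>f\<in>smooth_functions M.
           \<alpha> (Xs[i := (\<lambda>g. f * X g)]) = f * \<alpha> (Xs[i := X])) \<and>
        (\<forall>i<k. \<forall>j<k. i \<noteq> j \<and> Xs ! i = Xs ! j \<longrightarrow> \<alpha> Xs = 0)) \<and>
     (\<forall>Xs. \<not> (length Xs = k \<and> set Xs \<subseteq> vector_fields M) \<longrightarrow> \<alpha> Xs = 0)}"

definition interior :: "'a vfield \<Rightarrow> 'a dform \<Rightarrow> 'a dform" where
  "interior X \<alpha> = (\<lambda>Xs. \<alpha> (X # Xs))"

text \<open>Contraction with \<open>v\<^sub>1 \<and> \<dots> \<and> v\<^sub>k\<close>, in the convention \<open>\<iota>\<^bsub>v\<^sub>k\<^esub> \<cdots> \<iota>\<^bsub>v\<^sub>1\<^esub>\<close>.\<close>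

definition contraction :: "'a vfield list \<Rightarrow> 'a dform \<Rightarrow> 'a dform" where
  "contraction vs \<alpha> = fold interior vs \<alpha>"

definition omit :: "nat \<Rightarrow> 'b list \<Rightarrow> 'b list" where
  "omit i xs = take i xs @ drop (Suc i) xs"

text \<open>
  The de Rham differential, by its invariant formula
  \<open>(d\<alpha>)(X\<^sub>0, \<dots>, X\<^sub>k) = \<Sum>\<^sub>i (-1)\<^sup>i X\<^sub>i(\<alpha>(\<dots>, omit X\<^sub>i, \<dots>))
     + \<Sum>\<^sub>i\<^sub><\<^sub>j (-1)\<^sup>i\<^sup>+\<^sup>j \<alpha>([X\<^sub>i, X\<^sub>j], \<dots>, omit X\<^sub>i, \<dots>, omit X\<^sub>j, \<dots>)\<close>.
\<close>

definition ext_deriv :: "'a manifold \<Rightarrow> 'a dform \<Rightarrow> 'a dform" where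
  "ext_deriv M \<alpha> = (\<lambda>Xs. if set Xs \<subseteq> vector_fields M
     then (\<Sum>i<length Xs. (-1) ^ i *\<^sub>R (Xs ! i) (\<alpha> (omit i Xs))) +
          (\<Sum>j<length Xs. \<Sum>i<j.
             (-1) ^ (i + j) *\<^sub>R \<alpha> (lie_bracket (Xs ! i) (Xs ! j) # omit i (omit j Xs)))
     else 0)"

section \<open>Pre-n-plectic forms and Hamiltonian forms\<close>

definition pre_plectic :: "'a manifold \<Rightarrow> nat \<Rightarrow> 'a dform \<Rightarrow> bool" where
  "pre_plectic M n \<omega> \<longleftrightarrow> \<omega> \<in> forms M (n + 1) \<and> ext_deriv M \<omega> = 0"

definition ham_vector_field :: "'a manifold \<Rightarrow> 'a dform \<Rightarrow> 'a dform \<Rightarrow> 'a vfield \<Rightarrow> bool" where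
  "ham_vector_field M \<omega> \<alpha> v \<longleftrightarrow> v \<in> vector_fields M \<and> ext_deriv M \<alpha> = - interior v \<omega>"

definition ham_forms :: "'a manifold \<Rightarrow> nat \<Rightarrow> 'a dform \<Rightarrow> 'a dform set" where
  "ham_forms M n \<omega> = {\<alpha> \<in> forms M (n - 1). \<exists>v. ham_vector_field M \<omega> \<alpha> v}"

definition some_ham_vf :: "'a manifold \<Rightarrow> 'a dform \<Rightarrow> 'a dform \<Rightarrow> 'a vfield" where
  "some_ham_vf M \<omega> \<alpha> = (SOME v. ham_vector_field M \<omega> \<alpha> v)"

section \<open>Curved L-infinity algebras\<close>

text \<open>
  A graded vector space is given by its components \<open>W p\<close>, \<open>p \<in> \<int>\<close>. A homogeneous element is a
  pair of a degree \<open>p\<close> and an element of \<open>W p\<close>. A degree \<open>2 - k\<close> linear map on the \<open>k\<close>-th tensor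
  power is given by its multilinear values on lists of \<open>k\<close> homogeneous elements; one function on
  lists collects these maps for all \<open>k \<ge> 0\<close>. Positions in lists are counted from \<open>0\<close>.
\<close>

definition homogeneous :: "(int \<Rightarrow> 'v set) \<Rightarrow> (int \<times> 'v) set" where
  "homogeneous W = {(p, w). w \<in> W p}"

definition total_degree :: "(int \<times> 'v) list \<Rightarrow> int" where
  "total_degree ws = sum_list (map fst ws)"

definition permute_entries :: "(nat \<Rightarrow> nat) \<Rightarrow> 'b list \<Rightarrow> 'b list" where
  "permute_entries \<sigma> ws = map (\<lambda>a. ws ! \<sigma> a) [0..<length ws]"

text \<open>
  The Koszul sign, characterised by
  \<open>w\<^sub>1 \<odot> \<dots> \<odot> w\<^sub>m = \<epsilon>(\<sigma>) w\<^bsub>\<sigma>(1)\<^esub> \<odot> \<dots> \<odot> w\<^bsub>\<sigma>(m)\<^esub>\<close> in the graded symmetric algebra: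
  one factor for each inversion.
\<close>

definition koszul_sign :: "(nat \<Rightarrow> nat) \<Rightarrow> (int \<times> 'v) list \<Rightarrow> real" where
  "koszul_sign \<sigma> ws = (\<Prod>b<length ws. \<Prod>a<b.
     if \<sigma> b < \<sigma> a then (-1) powi (fst (ws ! \<sigma> a) * fst (ws ! \<sigma> b)) else 1)"

definition unshuffles :: "nat \<Rightarrow> nat \<Rightarrow> (nat \<Rightarrow> nat) set" where
  "unshuffles i m =
     {\<sigma>. \<sigma> permutes {..<m} \<and> strict_mono_on {..<i} \<sigma> \<and> strict_mono_on {i..<m} \<sigma>}"

definition multilinear_on ::
    "(int \<Rightarrow> 'v::real_vector set) \<Rightarrow> ((int \<times> 'v) list \<Rightarrow> 'v) \<Rightarrow> bool" where
  "multilinear_on W l \<longleftrightarrow>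
     (\<forall>ws\<in>lists (homogeneous W). \<forall>i<length ws. \<forall>p. \<forall>x\<in>W p. \<forall>y\<in>W p. \<forall>c.
        l (ws[i := (p, x + y)]) = l (ws[i := (p, x)]) + l (ws[i := (p, y)]) \<and>
        l (ws[i := (p, c *\<^sub>R x)]) = c *\<^sub>R l (ws[i := (p, x)]))"

definition graded_antisymmetric ::
    "(int \<Rightarrow> 'v::real_vector set) \<Rightarrow> ((int \<times> 'v) list \<Rightarrow> 'v) \<Rightarrow> bool" where
  "graded_antisymmetric W l \<longleftrightarrow>
     (\<forall>ws\<in>lists (homogeneous W). \<forall>\<sigma>. \<sigma> permutes {..<length ws} \<longrightarrow>
        l (permute_entries \<sigma> ws) = (of_int (sign \<sigma>) * koszul_sign \<sigma> ws) *\<^sub>R l ws)"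

text \<open>With \<open>i + j = m + 1\<close> and \<open>j \<ge> 1\<close>, the sign exponent \<open>i(j - 1)\<close> is \<open>i(m - i)\<close>.\<close>

definition curved_jacobi ::
    "(int \<Rightarrow> 'v::real_vector set) \<Rightarrow> ((int \<times> 'v) list \<Rightarrow> 'v) \<Rightarrow> bool" where
  "curved_jacobi W l \<longleftrightarrow>
     (\<forall>ws\<in>lists (homogeneous W). let m = length ws in
        (\<Sum>i\<le>m. (-1) ^ (i * (m - i)) *\<^sub>R
           (\<Sum>\<sigma>\<in>unshuffles i m. (of_int (sign \<sigma>) * koszul_sign \<sigma> ws) *\<^sub>R
              (let us = take i (permute_entries \<sigma> ws); vs = drop i (permute_entries \<sigma> ws)
               in l ((total_degree us + 2 - int i, l us) # vs)))) = 0)"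

definition curved_L_infinity ::
    "(int \<Rightarrow> 'v::real_vector set) \<Rightarrow> ((int \<times> 'v) list \<Rightarrow> 'v) \<Rightarrow> bool" where
  "curved_L_infinity W l \<longleftrightarrow>
     (\<forall>p. subspace (W p)) \<and>
     (\<forall>ws\<in>lists (homogeneous W). l ws \<in> W (total_degree ws + 2 - int (length ws))) \<and>
     multilinear_on W l \<and> graded_antisymmetric W l \<and> curved_jacobi W l"

section \<open>The complex and its multibrackets\<close>

text \<open>
  The one-dimensional space generated by \<open>\<omega>\<close> is a copy of the reals also when \<open>\<omega> = 0\<close>: elements
  of all components are pairs, where \<open>(c, 0)\<close> in degree \<open>2\<close> stands for \<open>c\<close> times the generator
  \<open>\<omega>\<close>, and \<open>(0, \<alpha>)\<close> in the other degrees stands for the form \<open>\<alpha>\<close>.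
\<close>

definition plectic_space ::
    "'a manifold \<Rightarrow> nat \<Rightarrow> 'a dform \<Rightarrow> int \<Rightarrow> (real \<times> 'a dform) set" where
  "plectic_space M n \<omega> p =
     (if p = 2 then UNIV \<times> {0}
      else if p = 1 then {0} \<times> forms M n
      else if p = 0 then {0} \<times> ham_forms M n \<omega>
      else if 1 - int n \<le> p \<and> p \<le> -1 then {0} \<times> forms M (nat (int n - 1 + p))
      else {0})"

definition varsigma :: "nat \<Rightarrow> real" where
  "varsigma k = - ((-1) ^ (k * (k + 1) div 2))"

definition ham_bracket :: "'a manifold \<Rightarrow> 'a dform \<Rightarrow> 'a dform list \<Rightarrow> 'a dform" where
  "ham_bracket M \<omega> \<alpha>s = varsigma (length \<alpha>s) *\<^sub>R contraction (map (some_ham_vf M \<omega>) \<alpha>s) \<omega>"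

text \<open>
  In the first case below all entries have degree \<open>0\<close>; for the empty list the value
  \<open>varsigma 0 *\<^sub>R \<omega> = - \<omega>\<close> lies in degree \<open>2\<close> and is thus the pair \<open>(varsigma 0, 0)\<close>. In the
  second case exactly one entry, at position \<open>length us\<close>, has a nonzero degree, namely \<open>2\<close>; it is
  \<open>c\<close> times the generator \<open>\<omega>\<close>, that is, \<open>- c\<close> times \<open>- \<omega>\<close>.
\<close>

definition plectic_bracket ::
    "'a manifold \<Rightarrow> 'a dform \<Rightarrow> (int \<times> real \<times> 'a dform) list \<Rightarrow> real \<times> 'a dform" where
  "plectic_bracket M \<omega> ws =
     (let us = takeWhile (\<lambda>w. fst w = 0) ws; form = (\<lambda>w. snd (snd w)) in
      case dropWhile (\<lambda>w. fst w = 0) ws of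
        [] \<Rightarrow> if ws = [] then (varsigma 0, 0) else (0, ham_bracket M \<omega> (map form ws))
      | (p, (c, _)) # vs \<Rightarrow>
          if p = 2 \<and> (\<forall>v\<in>set vs. fst v = 0) \<and> 2 \<le> length (us @ vs)
          then (0, (- c * (-1) ^ length us) *\<^sub>R
                     ext_deriv M (ham_bracket M \<omega> (map form (us @ vs))))
          else 0)"

end

theory Submission
  imports Defs
begin

text \<open>
  The theorem rests on one formula. A Hamiltonian vector field preserves \<open>\<omega>\<close>, because
  \<open>L\<^sub>v \<omega> = \<iota>\<^sub>v d \<omega> + d \<iota>\<^sub>v \<omega> = - d d \<alpha> = 0\<close>; and for fields preserving \<open>\<omega>\<close>, Cartan's calculus gives, with
  positions counted from \<open>0\<close>,
  \<open>d \<iota>(v\<^sub>1 \<and> \<dots> \<and> v\<^sub>m) \<omega> = (-1)\<^sup>m \<Sum>\<^sub>a\<^sub><\<^sub>b (-1)\<^sup>a\<^sup>+\<^sup>b \<iota>([v\<^sub>a, v\<^sub>b] \<and> \<dots>) \<omega>\<close>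
  (\<open>d_contraction\<close>). For \<open>m = 2\<close> it says that \<open>[v, w]\<close> is a Hamiltonian vector field of the binary bracket.
  Hence for general \<open>m\<close> it expresses \<open>d[\<alpha>\<^sub>1, \<dots>, \<alpha>\<^sub>m]\<close> as a signed sum of the nested brackets
  \<open>[[\<alpha>\<^sub>a, \<alpha>\<^sub>b], \<dots>]\<close> (\<open>d_ham_bracket\<close>); the signs \<open>\<varsigma>(m)\<close> are made for this. The formula also shows
  that differentials of brackets land in the right component. Brackets do not depend on the choice
  of Hamiltonian vector fields, since \<open>\<iota>\<^sub>v \<omega> = - d \<alpha>\<close> does not (\<open>ham_bracket_eq\<close>); this also gives
  their multilinearity.

  In the Jacobi identities almost everything vanishes for degree reasons (\<open>jacobi_sum\<close>): the outer
  bracket needs a first argument of degree \<open>0\<close> or \<open>2\<close>, which leaves the terms with an inner bracket of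
  arity \<open>0\<close> or \<open>2\<close> with arguments of degree \<open>0\<close>, and a term in which the inner bracket is a differential
  of degree \<open>0\<close>; the latter vanishes because a closed form has the Hamiltonian vector field \<open>0\<close>. If all
  arguments have degree \<open>0\<close>, what remains is \<open>d[\<alpha>\<^sub>1, \<dots>, \<alpha>\<^sub>m]\<close> together with the nested binary brackets,
  that is, the formula above (\<open>jacobi_zero_degree\<close>). If exactly one argument is a multiple of the
  generator \<open>\<omega>\<close>, what remains is the differential of that formula, a multiple of
  \<open>d d[\<alpha>\<^sub>1, \<dots>, \<alpha>\<^sub>m] = 0\<close> (\<open>jacobi_degree_two\<close>). In all other cases every term is zero
  (\<open>jacobi_other\<close>).

  The Cartan calculus has to be built from the invariant formula for \<open>d\<close>. It is developed for
  alternating additive maps, where \<open>d d = 0\<close> and all commutator relations follow by induction on the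
  degree from the recursion \<open>\<iota>\<^sub>X d = L\<^sub>X - d \<iota>\<^sub>X\<close> (\<open>cartan\<close>). The manifold enters through
  the algebra of smooth functions, whose derivations are the vector fields.
\<close>

section \<open>The algebra of smooth functions\<close>

text \<open>
  Partial derivatives at a point of an open chart image depend only on the values of the function
  on that image, because a short piece of every coordinate line stays inside it. This is what makes
  \<open>C\<^sup>k\<close> on an open set stable under replacing a function by one that agrees with it there, and hence
  lets the sum and product rules for derivatives be used under iterated partial derivatives.
\<close>

lemma eventually_coordinate_line:
  assumes "openin (Euclidean_space m) V" "x \<in> V" "i < m"
  shows "\<forall>\<^sub>F t in nhds (x i). x(i := t) \<in> V"
proof -
  have x0: "x j = 0" if "j \<ge> m" for j
    using openin_subset[OF assms(1)] assms(2) that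
    by (auto simp: topspace_Euclidean_space)
  have "continuous_map euclideanreal (powertop_real UNIV) (\<lambda>t. x(i := t))"
    unfolding continuous_map_componentwise_UNIV
  proof
    fix j show "continuous_map euclideanreal euclideanreal (\<lambda>t. (x(i := t)) j)"
      by (cases "j = i") auto
  qed
  then have "continuous_map euclideanreal (Euclidean_space m) (\<lambda>t. x(i := t))"
    using assms(3) x0
    by (auto simp: Euclidean_space_def continuous_map_in_subtopology)
  then have "open {t. x(i := t) \<in> V}"
    using openin_continuous_map_preimage[OF _ assms(1), of euclideanreal "\<lambda>t. x(i := t)"] by simp
  then show ?thesis
    using assms(2) unfolding eventually_nhds
    by (intro exI[of _ "{t. x(i := t) \<in> V}"]) simp
qed

lemma partial_deriv_cong:
  assumes V: "openin (Euclidean_space m) V" "x \<in> V" "i < m"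
    and eq: "\<And>y. y \<in> V \<Longrightarrow> f y = g y"
  shows "partial_deriv i f x = partial_deriv i g x"
proof -
  have "\<forall>\<^sub>F t in nhds (x i). f (x(i := t)) = g (x(i := t))"
    using eventually_coordinate_line[OF V] by (rule eventually_mono) (rule eq)
  then show ?thesis
    unfolding partial_deriv_def by (rule deriv_cong_ev) (rule refl)
qed

lemma field_differentiable_line_cong:
  fixes f g :: "(nat \<Rightarrow> real) \<Rightarrow> real"
  assumes V: "openin (Euclidean_space m) V" "x \<in> V" "i < m"
    and eq: "\<And>y. y \<in> V \<Longrightarrow> f y = g y"
    and f: "(\<lambda>t. f (x(i := t))) field_differentiable at (x i)"
  shows "(\<lambda>t. g (x(i := t))) field_differentiable at (x i)"
proof -
  have "\<forall>\<^sub>F t in nhds (x i). f (x(i := t)) = g (x(i := t))"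
    using eventually_coordinate_line[OF V] by (rule eventually_mono) (rule eq)
  then show ?thesis
    using f unfolding field_differentiable_def by (simp only: DERIV_cong_ev[OF refl _ refl])
qed

lemma C_k_on_cong:
  assumes V: "openin (Euclidean_space m) V"
    and eq: "\<And>y. y \<in> V \<Longrightarrow> f y = g y" and f: "C_k_on m V k f"
  shows "C_k_on m V k g"
  using eq f
proof (induction k arbitrary: f g)
  case 0
  then show ?case
    by (auto elim: continuous_map_eq)
next
  case (Suc k)
  have "C_k_on m V k (partial_deriv i g)" if "i < m" for i
    using Suc.prems(2) that
    by (intro Suc.IH[of "partial_deriv i f" "partial_deriv i g"] partial_deriv_cong[OF V _ that] Suc.prems(1)) auto
  moreover have "(\<lambda>t. g (x(i := t))) field_differentiable at (x i)" if "i < m" "x \<in> V" for i x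
  proof -
    have "(\<lambda>t. f (x(i := t))) field_differentiable at (x i)"
      using Suc.prems(2) that by (auto simp del: fun_upd_apply)
    then show ?thesis
      by (rule field_differentiable_line_cong[OF V that(2,1), of f g, rotated])
         (rule Suc.prems(1))
  qed
  moreover have "continuous_map (subtopology (Euclidean_space m) V) euclideanreal g"
    by (rule continuous_map_eq[of _ _ f]) (use Suc.prems in auto)
  ultimately show ?case by simp
qed

lemma C_k_on_Suc_imp: "C_k_on m V (Suc k) f \<Longrightarrow> C_k_on m V k f"
proof (induction k arbitrary: f)
  case (Suc k)
  then show ?case unfolding C_k_on.simps(2)[of m V "Suc k"] C_k_on.simps(2)[of m V k] by blast
qed simp

lemma C_k_on_const: "C_k_on m V k (\<lambda>_. c)"
proof (induction k arbitrary: c)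
  case (Suc k)
  have "partial_deriv i (\<lambda>_. c) = (\<lambda>_. 0)" for i
    by (simp add: partial_deriv_def fun_eq_iff)
  with Suc show ?case by simp
qed simp

lemma C_k_on_add:
  assumes V: "openin (Euclidean_space m) V"
  shows "C_k_on m V k f \<Longrightarrow> C_k_on m V k g \<Longrightarrow> C_k_on m V k (\<lambda>x. f x + g x)"
proof (induction k arbitrary: f g)
  case 0
  then show ?case by (auto intro: continuous_map_add)
next
  case (Suc k)
  have "C_k_on m V k (partial_deriv i (\<lambda>x. f x + g x))" if "i < m" for i
  proof (rule C_k_on_cong[OF V])
    show "C_k_on m V k (\<lambda>x. partial_deriv i f x + partial_deriv i g x)"
      using Suc that by auto
    show "partial_deriv i f x + partial_deriv i g x = partial_deriv i (\<lambda>x. f x + g x) x"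
      if "x \<in> V" for x
      using Suc.prems that \<open>i < m\<close> by (simp add: partial_deriv_def)
  qed
  with Suc.prems show ?case
    by (auto intro: continuous_map_add field_differentiable_add)
qed

lemma C_k_on_mult:
  assumes V: "openin (Euclidean_space m) V"
  shows "C_k_on m V k f \<Longrightarrow> C_k_on m V k g \<Longrightarrow> C_k_on m V k (\<lambda>x. f x * g x)"
proof (induction k arbitrary: f g)
  case 0
  then show ?case by (auto intro: continuous_map_real_mult)
next
  case (Suc k)
  have "C_k_on m V k (partial_deriv i (\<lambda>x. f x * g x))" if "i < m" for i
  proof (rule C_k_on_cong[OF V])
    show "C_k_on m V k (\<lambda>x. f x * partial_deriv i g x + partial_deriv i f x * g x)"
    proof (intro C_k_on_add[OF V] Suc.IH)
      show "C_k_on m V k f" "C_k_on m V k g"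
        using Suc.prems by (blast intro: C_k_on_Suc_imp)+
      show "C_k_on m V k (partial_deriv i f)" "C_k_on m V k (partial_deriv i g)"
        using Suc.prems that by simp_all
    qed
    show "f x * partial_deriv i g x + partial_deriv i f x * g x = partial_deriv i (\<lambda>x. f x * g x) x"
      if "x \<in> V" for x
      using Suc.prems that \<open>i < m\<close> by (simp add: partial_deriv_def)
  qed
  with Suc.prems show ?case
    by (auto intro: continuous_map_real_mult field_differentiable_mult)
qed

locale smooth_mfd =
  fixes M :: "'a::{t2_space, second_countable_topology} manifold"
  assumes smooth: "smooth_manifold M"
begin

abbreviation "\<A> \<equiv> smooth_functions M"
abbreviation "\<V> \<equiv> vector_fields M"

lemma chart_image_open: "(U, \<phi>) \<in> atlas M \<Longrightarrow> openin (Euclidean_space (mdim M)) (\<phi> ` U)"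
  using smooth by (auto simp: smooth_manifold_def is_chart_def)

lemma smooth_functions_iff:
  "f \<in> \<A> \<longleftrightarrow> (\<forall>U \<phi> k. (U, \<phi>) \<in> atlas M \<longrightarrow> C_k_on (mdim M) (\<phi> ` U) k (\<lambda>y. f (inv_into U \<phi> y)))"
  unfolding smooth_functions_def smooth_on_def by blast

lemma const_smooth: "(\<lambda>_. c) \<in> \<A>"
  unfolding smooth_functions_iff by (blast intro: C_k_on_const)

lemma add_smooth: "f \<in> \<A> \<Longrightarrow> g \<in> \<A> \<Longrightarrow> f + g \<in> \<A>"
  unfolding smooth_functions_iff plus_fun_apply times_fun_apply
  by (intro allI impI C_k_on_add) (blast intro: chart_image_open)+

lemma mult_smooth: "f \<in> \<A> \<Longrightarrow> g \<in> \<A> \<Longrightarrow> f * g \<in> \<A>"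
  unfolding smooth_functions_iff plus_fun_apply times_fun_apply
  by (intro allI impI C_k_on_mult) (blast intro: chart_image_open)+

lemma subspace_smooth: "subspace \<A>"
proof (rule subspaceI)
  show "0 \<in> \<A>" using const_smooth[of 0] by (simp add: zero_fun_def)
  show "c *\<^sub>R f \<in> \<A>" if "f \<in> \<A>" for c f
    using mult_smooth[OF const_smooth that, of c]
    by (simp add: scaleR_fun_def times_fun_def)
qed (rule add_smooth)

end

section \<open>Vector fields\<close>

lemma omit_Cons [simp]: "omit 0 (x # xs) = xs" "omit (Suc i) (x # xs) = x # omit i xs"
  by (simp_all add: omit_def)

lemma set_omit_subset: "set (omit i xs) \<subseteq> set xs"
  by (auto simp: omit_def dest: in_set_takeD in_set_dropD)

lemma length_omit: "i < length xs \<Longrightarrow> length (omit i xs) = length xs - 1"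
  by (simp add: omit_def)

lemma omit_append:
  "omit i (xs @ ys) = (if i < length xs then omit i xs @ ys else xs @ omit (i - length xs) ys)"
  by (auto simp: omit_def Suc_diff_le)

lemma sum_fun_apply [simp]: "(\<Sum>i\<in>I. f i) x = (\<Sum>i\<in>I. f i x)"
  by (induction I rule: infinite_finite_induct) auto

lemma scaleR_fun_apply [simp]: "(c *\<^sub>R f) x = c *\<^sub>R f x"
  by (simp add: scaleR_fun_def)

lemma interior_apply: "interior X \<alpha> Xs = \<alpha> (X # Xs)"
  by (simp add: interior_def)

lemma interior_add: "interior X (\<alpha> + \<beta>) = interior X \<alpha> + interior X \<beta>"
  and interior_diff: "interior X (\<alpha> - \<beta>) = interior X \<alpha> - interior X \<beta>"
  and interior_scale: "interior X (c *\<^sub>R \<alpha>) = c *\<^sub>R interior X \<alpha>"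
  and interior_zero [simp]: "interior X 0 = 0"
  by (simp_all add: fun_eq_iff interior_apply)

context smooth_mfd begin

lemma vfD:
  assumes "X \<in> \<V>"
  shows vf_smooth: "f \<in> \<A> \<Longrightarrow> X f \<in> \<A>"
    and vf_add: "f \<in> \<A> \<Longrightarrow> g \<in> \<A> \<Longrightarrow> X (f + g) = X f + X g"
    and vf_scale: "f \<in> \<A> \<Longrightarrow> X (c *\<^sub>R f) = c *\<^sub>R X f"
    and vf_mult: "f \<in> \<A> \<Longrightarrow> g \<in> \<A> \<Longrightarrow> X (f * g) = f * X g + g * X f"
    and vf_undefined: "f \<notin> \<A> \<Longrightarrow> X f = 0"
  using assms by (auto simp: vector_fields_def)

lemmas smooth_closed = subspace_0[OF subspace_smooth] subspace_add[OF subspace_smooth]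
  subspace_diff[OF subspace_smooth] subspace_scale[OF subspace_smooth]
  subspace_sum[OF subspace_smooth]

lemma vf_zero: "X \<in> \<V> \<Longrightarrow> X 0 = 0"
  using vf_scale[of X 0 0] smooth_closed by simp

lemma vf_diff: "X \<in> \<V> \<Longrightarrow> f \<in> \<A> \<Longrightarrow> g \<in> \<A> \<Longrightarrow> X (f - g) = X f - X g"
  using vf_add[of X f "(-1) *\<^sub>R g"] vf_scale[of X g "-1"] smooth_closed(4)[of g "-1"] by simp

lemma subspace_vector_fields: "subspace \<V>"
proof (rule subspaceI)
  show "0 \<in> \<V>"
    by (auto simp: vector_fields_def smooth_closed)
next
  fix X Y assume XY: "X \<in> \<V>" "Y \<in> \<V>"
  note d = vfD[OF XY(1)] vfD[OF XY(2)]
  show "X + Y \<in> \<V>"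
    by (auto simp: vector_fields_def d smooth_closed algebra_simps)
next
  fix c X assume X: "X \<in> \<V>"
  note d = vfD[OF X]
  show "c *\<^sub>R X \<in> \<V>"
    by (auto simp: vector_fields_def d smooth_closed algebra_simps)
qed

lemma lie_bracket_vf:
  assumes "X \<in> \<V>" "Y \<in> \<V>"
  shows "lie_bracket X Y \<in> \<V>"
proof -
  note d = vfD[OF assms(1)] vfD[OF assms(2)]
  show ?thesis
    by (auto simp: vector_fields_def lie_bracket_def d smooth_closed mult_smooth vf_zero assms algebra_simps)
qed

lemma lie_bracket_apply: "lie_bracket X Y f = X (Y f) - Y (X f)"
  by (simp add: lie_bracket_def)

lemma lie_bracket_self [simp]: "lie_bracket X X = 0"
  by (simp add: lie_bracket_def fun_eq_iff)

lemma lie_bracket_add_left: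
  assumes "X \<in> \<V>" "Y \<in> \<V>" "Z \<in> \<V>"
  shows "lie_bracket (X + Y) Z = lie_bracket X Z + lie_bracket Y Z"
proof (intro ext)
  fix f x show "lie_bracket (X + Y) Z f x = (lie_bracket X Z + lie_bracket Y Z) f x"
    using assms
    by (cases "f \<in> \<A>")
       (simp_all add: lie_bracket_apply vf_add vf_smooth vf_undefined vf_zero zero_fun_def[symmetric])
qed

lemma lie_bracket_anti: "lie_bracket X Y = - lie_bracket Y X"
  by (simp add: lie_bracket_def fun_eq_iff)

lemma lie_bracket_add_right:
  assumes "X \<in> \<V>" "Y \<in> \<V>" "Z \<in> \<V>"
  shows "lie_bracket Z (X + Y) = lie_bracket Z X + lie_bracket Z Y"
  using lie_bracket_add_left[OF assms] lie_bracket_anti[of Z] by simp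

text \<open>
  The Jacobi identity in the form needed for commutators of Lie derivatives. Outside the smooth
  functions both sides vanish because vector fields are zero there.
\<close>

lemma lie_bracket_jacobi:
  assumes "X \<in> \<V>" "Y \<in> \<V>" "Z \<in> \<V>"
  shows "lie_bracket (lie_bracket X Y) Z = lie_bracket X (lie_bracket Y Z) - lie_bracket Y (lie_bracket X Z)"
proof (intro ext)
  fix f x show "lie_bracket (lie_bracket X Y) Z f x
      = (lie_bracket X (lie_bracket Y Z) - lie_bracket Y (lie_bracket X Z)) f x"
    using assms
    by (cases "f \<in> \<A>")
       (simp_all add: lie_bracket_apply vf_diff vf_smooth vf_undefined vf_zero zero_fun_def[symmetric])
qed

section \<open>Alternating cochains\<close>

text \<open>
  The complex of alternating, additive maps from vector fields to smooth functions, without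
  linearity over functions: it contains the differential forms, and it is closed under \<open>d\<close> and under
  Lie derivatives, which makes the Cartan calculus below a purely algebraic matter. The recursion
  over the degree replaces "alternating" by \<open>\<iota>\<^sub>X \<iota>\<^sub>X \<alpha> = 0\<close> at every depth, so that identities between
  cochains can be proved by contracting with a vector field and using induction on the degree.
\<close>

primrec cochains :: "nat \<Rightarrow> 'a dform set" where
  "cochains 0 = {\<alpha>. \<alpha> [] \<in> \<A> \<and> (\<forall>X. interior X \<alpha> = 0)}"
| "cochains (Suc k) = {\<alpha>. \<alpha> [] = 0 \<and> (\<forall>X. X \<notin> \<V> \<longrightarrow> interior X \<alpha> = 0) \<and>
     (\<forall>X\<in>\<V>. interior X \<alpha> \<in> cochains k \<and> interior X (interior X \<alpha>) = 0) \<and>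
     (\<forall>X\<in>\<V>. \<forall>Y\<in>\<V>. interior (X + Y) \<alpha> = interior X \<alpha> + interior Y \<alpha>)}"

lemma subspace_cochains: "subspace (cochains k)"
proof (induction k)
  case 0
  show ?case
    by (rule subspaceI) (auto simp: interior_add interior_scale smooth_closed)
next
  case (Suc k)
  note s = subspace_0[OF Suc] subspace_add[OF Suc] subspace_scale[OF Suc]
  show ?case
    by (rule subspaceI) (auto simp: interior_add interior_scale s algebra_simps)
qed

lemmas cochains_closed = subspace_0[OF subspace_cochains] subspace_add[OF subspace_cochains]
  subspace_diff[OF subspace_cochains] subspace_scale[OF subspace_cochains]
  subspace_sum[OF subspace_cochains] subspace_neg[OF subspace_cochains]

lemma interior_outside:
  "\<alpha> \<in> cochains k \<Longrightarrow> X \<notin> \<V> \<Longrightarrow> interior X \<alpha> = 0"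
  by (cases k) auto

text \<open>
  The truncated subtraction is intended: in degree \<open>0\<close> the contraction is zero, which is a cochain of
  any degree. Statements about a cochain and its contraction then need no case distinction.
\<close>

lemma interior_in_cochains:
  "\<alpha> \<in> cochains k \<Longrightarrow> interior X \<alpha> \<in> cochains (k - 1)"
  by (cases k; cases "X \<in> \<V>") (auto simp: cochains_closed smooth_closed)

lemma interior_add_left:
  "\<alpha> \<in> cochains k \<Longrightarrow> X \<in> \<V> \<Longrightarrow> Y \<in> \<V> \<Longrightarrow> interior (X + Y) \<alpha> = interior X \<alpha> + interior Y \<alpha>"
  by (cases k) auto

lemma interior_twice:
  "\<alpha> \<in> cochains k \<Longrightarrow> interior X (interior X \<alpha>) = 0"
  by (cases k; cases "X \<in> \<V>") auto

text \<open>
  Polarisation of \<open>\<iota>\<^sub>Z \<iota>\<^sub>Z \<alpha> = 0\<close> at \<open>Z = X + Y\<close>.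
\<close>

lemma interior_anti:
  assumes "\<alpha> \<in> cochains k"
  shows "interior X (interior Y \<alpha>) = - interior Y (interior X \<alpha>)"
proof (cases "X \<in> \<V> \<and> Y \<in> \<V>")
  case True
  have "0 = interior (X + Y) (interior (X + Y) \<alpha>)"
    using interior_twice[OF assms] by simp
  also have "\<dots> = interior (X + Y) (interior X \<alpha>) + interior (X + Y) (interior Y \<alpha>)"
    using True assms by (simp add: interior_add_left interior_add)
  also have "\<dots> = interior Y (interior X \<alpha>) + interior X (interior Y \<alpha>)"
    using True assms
    by (simp add: interior_add_left[OF interior_in_cochains[OF assms]] interior_twice)
  finally show ?thesis by (simp add: eq_neg_iff_add_eq_0 add.commute)
next
  case False
  then show ?thesis
    using interior_outside[OF assms] interior_outside[OF interior_in_cochains[OF assms]] by auto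
qed

lemma interior_zero_left:
  assumes "\<alpha> \<in> cochains k"
  shows "interior 0 \<alpha> = 0"
  using interior_add_left[OF assms, of 0 0] subspace_0[OF subspace_vector_fields] by simp

lemma interior_uminus_left:
  assumes "\<alpha> \<in> cochains k" "X \<in> \<V>"
  shows "interior (- X) \<alpha> = - interior X \<alpha>"
  using interior_add_left[OF assms, of "- X"] subspace_neg[OF subspace_vector_fields]
    interior_zero_left[OF assms(1)] assms(2) by (simp add: eq_neg_iff_add_eq_0 add.commute)

lemma interior_diff_left:
  assumes "\<alpha> \<in> cochains k" "X \<in> \<V>" "Y \<in> \<V>"
  shows "interior (X - Y) \<alpha> = interior X \<alpha> - interior Y \<alpha>"
  using interior_add_left[OF assms(1,2), of "- Y"] interior_uminus_left[OF assms(1,3)]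
    subspace_neg[OF subspace_vector_fields] assms by simp

lemma cochain_smooth: "\<alpha> \<in> cochains k \<Longrightarrow> \<alpha> Xs \<in> \<A>"
proof (induction Xs arbitrary: \<alpha> k)
  case Nil
  then show ?case using const_smooth[of 0] by (cases k) auto
next
  case (Cons X Xs)
  from Cons.IH[OF interior_in_cochains[OF Cons.prems]] show ?case
    by (simp only: interior_apply)
qed

lemma cochain_outside: "\<alpha> \<in> cochains k \<Longrightarrow> \<not> set Xs \<subseteq> \<V> \<Longrightarrow> \<alpha> Xs = 0"
proof (induction Xs arbitrary: \<alpha> k)
  case (Cons X Xs)
  show ?case
  proof (cases "X \<in> \<V>")
    case True
    with Cons.prems(2) have "\<not> set Xs \<subseteq> \<V>" by simp
    from Cons.IH[OF interior_in_cochains[OF Cons.prems(1)] this] show ?thesis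
      by (simp only: interior_apply)
  next
    case False
    from interior_outside[OF Cons.prems(1) this] show ?thesis
      by (metis interior_apply zero_fun_apply)
  qed
qed simp

lemma cochain_swap: "\<alpha> \<in> cochains k \<Longrightarrow> \<alpha> (X # Y # Zs) = - \<alpha> (Y # X # Zs)"
  using fun_cong[OF interior_anti, of \<alpha> k Y X Zs] by (simp add: interior_apply)

lemma cochain_to_front:
  "\<alpha> \<in> cochains k \<Longrightarrow> \<alpha> (us @ X # Xs) = (-1) ^ length us *\<^sub>R \<alpha> (X # us @ Xs)"
proof (induction us arbitrary: \<alpha> k)
  case (Cons u us)
  have "\<alpha> (u # us @ X # Xs) = (-1) ^ length us *\<^sub>R \<alpha> (u # X # us @ Xs)"
    using Cons.IH[OF interior_in_cochains[OF Cons.prems], of u] by (simp only: interior_apply)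
  also have "\<dots> = (-1) ^ length (u # us) *\<^sub>R \<alpha> (X # (u # us) @ Xs)"
    by (simp add: cochain_swap[OF Cons.prems, of u X])
  finally show ?case by simp
qed simp

lemma cochain_update:
  assumes "\<alpha> \<in> cochains k" "j < length Xs"
  shows "\<alpha> (Xs[j := X]) = (-1) ^ j *\<^sub>R \<alpha> (X # omit j Xs)"
  using cochain_to_front[OF assms(1), of "take j Xs" X "drop (Suc j) Xs"] assms(2)
  by (simp add: upd_conv_take_nth_drop omit_def)

text \<open>
  The extensionality principle behind the inductions on the degree.
\<close>

lemma cochain_eqI:
  assumes "\<alpha> \<in> cochains (Suc k)" "\<beta> \<in> cochains (Suc k)"
    and "\<And>X. X \<in> \<V> \<Longrightarrow> interior X \<alpha> = interior X \<beta>"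
  shows "\<alpha> = \<beta>"
proof
  fix Xs
  show "\<alpha> Xs = \<beta> Xs"
  proof (cases Xs)
    case Nil
    then show ?thesis using assms(1,2) by simp
  next
    case (Cons X Ys)
    have "interior X \<alpha> = interior X \<beta>"
      using interior_outside[OF assms(1)] interior_outside[OF assms(2)] assms(3)
      by (cases "X \<in> \<V>") auto
    then show ?thesis using Cons by (metis interior_apply)
  qed
qed

section \<open>Cartan calculus\<close>

text \<open>
  The guard keeps the value zero outside the vector fields, where a single bad argument could be
  repaired by the bracket.
\<close>

definition lie_deriv :: "'a vfield \<Rightarrow> 'a dform \<Rightarrow> 'a dform" where
  "lie_deriv X \<alpha> = (\<lambda>Xs. if set Xs \<subseteq> \<V>
     then X (\<alpha> Xs) - (\<Sum>j<length Xs. \<alpha> (Xs[j := lie_bracket X (Xs ! j)])) else 0)"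

lemma lie_deriv_add:
  assumes "X \<in> \<V>" "\<alpha> \<in> cochains k" "\<beta> \<in> cochains k"
  shows "lie_deriv X (\<alpha> + \<beta>) = lie_deriv X \<alpha> + lie_deriv X \<beta>"
  unfolding lie_deriv_def
  using cochain_smooth[OF assms(2)] cochain_smooth[OF assms(3)] assms(1)
  by (intro ext) (simp add: vf_add sum.distrib)

lemma lie_deriv_scale:
  assumes "X \<in> \<V>" "\<alpha> \<in> cochains k"
  shows "lie_deriv X (c *\<^sub>R \<alpha>) = c *\<^sub>R lie_deriv X \<alpha>"
  unfolding lie_deriv_def
  using cochain_smooth[OF assms(2)] assms(1)
  by (intro ext) (simp add: vf_scale sum_distrib_left right_diff_distrib)

lemma lie_deriv_diff:
  assumes "X \<in> \<V>" "\<alpha> \<in> cochains k" "\<beta> \<in> cochains k"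
  shows "lie_deriv X (\<alpha> - \<beta>) = lie_deriv X \<alpha> - lie_deriv X \<beta>"
  using lie_deriv_add[of X \<alpha> k "(-1) *\<^sub>R \<beta>"] lie_deriv_scale[of X \<beta> k "-1"] assms
    cochains_closed(4)[of \<beta> k "-1"] by simp

lemma lie_deriv_zero [simp]: "X \<in> \<V> \<Longrightarrow> lie_deriv X 0 = 0"
  by (auto simp: lie_deriv_def fun_eq_iff vf_zero)

text \<open>
  The relation \<open>[L\<^sub>X, \<iota>\<^sub>Y] = \<iota>\<^bsub>[X,Y]\<^esub>\<close>: contracting with \<open>Y\<close> fixes the first argument, and the only
  term of the Lie derivative that touches it is the one with \<open>[X, Y]\<close>.
\<close>

lemma interior_lie_deriv:
  assumes "X \<in> \<V>" "Y \<in> \<V>" "\<alpha> \<in> cochains k"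
  shows "interior Y (lie_deriv X \<alpha>) = lie_deriv X (interior Y \<alpha>) - interior (lie_bracket X Y) \<alpha>"
proof (intro ext)
  fix Xs x
  show "interior Y (lie_deriv X \<alpha>) Xs x
      = (lie_deriv X (interior Y \<alpha>) - interior (lie_bracket X Y) \<alpha>) Xs x"
  proof (cases "set Xs \<subseteq> \<V>")
    case True
    then show ?thesis
      using assms by (simp add: interior_apply lie_deriv_def sum.lessThan_Suc_shift del: sum.lessThan_Suc)
  next
    case False
    then show ?thesis
      by (simp add: interior_apply lie_deriv_def cochain_outside[OF assms(3)])
  qed
qed

lemma lie_deriv_in_cochains:
  "X \<in> \<V> \<Longrightarrow> \<alpha> \<in> cochains k \<Longrightarrow> lie_deriv X \<alpha> \<in> cochains k"
proof (induction k arbitrary: \<alpha>)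
  case 0
  have i: "interior Y \<alpha> = 0" for Y
    using 0 by simp
  have "interior Y (lie_deriv X \<alpha>) = 0" for Y
  proof (cases "Y \<in> \<V>")
    case True
    show ?thesis by (simp add: interior_lie_deriv[OF 0(1) True 0(2)] i 0(1))
  qed (simp add: interior_apply fun_eq_iff lie_deriv_def)
  moreover have "lie_deriv X \<alpha> [] \<in> \<A>"
    using 0 by (simp add: lie_deriv_def vf_smooth)
  ultimately show ?case by simp
next
  case (Suc k)
  note X = Suc.prems(1) and \<alpha> = Suc.prems(2)
  have i: "interior Y \<alpha> \<in> cochains k" for Y
    using interior_in_cochains[OF \<alpha>] by simp
  have nil: "\<alpha> [] = 0"
    using \<alpha> by simp
  have "lie_deriv X \<alpha> [] = 0"
    by (simp add: lie_deriv_def vf_zero X nil zero_fun_def[symmetric])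
  moreover have "interior Y (lie_deriv X \<alpha>) = 0" if "Y \<notin> \<V>" for Y
    using that by (simp add: interior_apply lie_deriv_def fun_eq_iff)
  moreover have "interior Y (lie_deriv X \<alpha>) \<in> cochains k" if "Y \<in> \<V>" for Y
    using Suc.IH[OF X i] i
    by (simp add: interior_lie_deriv[OF X that \<alpha>] cochains_closed)
  moreover have "interior Y (interior Y (lie_deriv X \<alpha>)) = 0" if "Y \<in> \<V>" for Y
    using interior_lie_deriv[OF X that i, of Y] interior_twice[OF \<alpha>] X
      interior_anti[OF \<alpha>, of "lie_bracket X Y" Y]
    by (simp add: interior_lie_deriv[OF X that \<alpha>] interior_diff)
  moreover have "interior (Y + Z) (lie_deriv X \<alpha>) = interior Y (lie_deriv X \<alpha>) + interior Z (lie_deriv X \<alpha>)"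
    if YZ: "Y \<in> \<V>" "Z \<in> \<V>" for Y Z
    using X YZ
    by (simp add: interior_lie_deriv[OF X _ \<alpha>] interior_add_left[OF \<alpha>] lie_deriv_add[OF X i i]
        lie_bracket_vf lie_bracket_add_right subspace_add[OF subspace_vector_fields])
  ultimately show ?case by simp
qed

lemma lie_deriv_add_left:
  assumes "\<alpha> \<in> cochains k" "X \<in> \<V>" "Y \<in> \<V>"
  shows "lie_deriv (X + Y) \<alpha> = lie_deriv X \<alpha> + lie_deriv Y \<alpha>"
proof
  fix Xs
  have "\<alpha> (Xs[j := lie_bracket (X + Y) (Xs ! j)])
      = \<alpha> (Xs[j := lie_bracket X (Xs ! j)]) + \<alpha> (Xs[j := lie_bracket Y (Xs ! j)])"
    if "j < length Xs" "set Xs \<subseteq> \<V>" for j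
  proof -
    have j: "Xs ! j \<in> \<V>" using that by auto
    have "\<alpha> ((lie_bracket X (Xs ! j) + lie_bracket Y (Xs ! j)) # omit j Xs)
        = \<alpha> (lie_bracket X (Xs ! j) # omit j Xs) + \<alpha> (lie_bracket Y (Xs ! j) # omit j Xs)"
      using fun_cong[OF interior_add_left[OF assms(1) lie_bracket_vf[OF assms(2) j]
            lie_bracket_vf[OF assms(3) j]], of "omit j Xs"]
      by (simp only: interior_apply plus_fun_apply)
    then show ?thesis
      by (simp only: cochain_update[OF assms(1) that(1)] lie_bracket_add_left[OF assms(2,3) j]
          scaleR_add_right)
  qed
  then show "lie_deriv (X + Y) \<alpha> Xs = (lie_deriv X \<alpha> + lie_deriv Y \<alpha>) Xs"
    by (auto simp: lie_deriv_def sum.distrib)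
qed

text \<open>
  The relation \<open>L\<^bsub>[X,Y]\<^esub> = [L\<^sub>X, L\<^sub>Y]\<close>, by induction on the degree: contract both sides with \<open>Z\<close> and move
  the contraction inside. The mixed terms \<open>L\<^sub>X \<iota>\<^bsub>[Y,Z]\<^esub>\<close> and \<open>L\<^sub>Y \<iota>\<^bsub>[X,Z]\<^esub>\<close> are symmetric in \<open>X\<close> and \<open>Y\<close> and cancel,
  and the remaining double brackets match by the Jacobi identity.
\<close>

lemma lie_deriv_bracket:
  "X \<in> \<V> \<Longrightarrow> Y \<in> \<V> \<Longrightarrow> \<alpha> \<in> cochains k \<Longrightarrow>
    lie_deriv (lie_bracket X Y) \<alpha> = lie_deriv X (lie_deriv Y \<alpha>) - lie_deriv Y (lie_deriv X \<alpha>)"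
proof (induction k arbitrary: \<alpha>)
  case 0
  note X = 0(1) and Y = 0(2) and \<alpha> = 0(3)
  have "\<beta> (Z # Zs) = 0" if "\<beta> \<in> cochains 0" for \<beta> :: "'a dform" and Z Zs
    using that by (auto simp: fun_eq_iff interior_apply)
  note c = this[OF lie_deriv_in_cochains, OF _ lie_deriv_in_cochains]
    this[OF lie_deriv_in_cochains]
  show ?case
  proof
    fix Xs
    show "lie_deriv (lie_bracket X Y) \<alpha> Xs = (lie_deriv X (lie_deriv Y \<alpha>) - lie_deriv Y (lie_deriv X \<alpha>)) Xs"
    proof (cases Xs)
      case Nil
      then show ?thesis by (simp add: lie_deriv_def lie_bracket_apply)
    next
      case (Cons Z Zs)
      show ?thesis by (simp add: Cons c X Y \<alpha> lie_bracket_vf del: cochains.simps)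
    qed
  qed
next
  case (Suc k)
  note X = Suc.prems(1) and Y = Suc.prems(2) and \<alpha> = Suc.prems(3)
  have i: "interior Z \<alpha> \<in> cochains k" for Z
    using interior_in_cochains[OF \<alpha>] by simp
  have two: "interior Z (lie_deriv X (lie_deriv Y \<alpha>))
      = lie_deriv X (lie_deriv Y (interior Z \<alpha>)) - lie_deriv X (interior (lie_bracket Y Z) \<alpha>)
        - lie_deriv Y (interior (lie_bracket X Z) \<alpha>) + interior (lie_bracket Y (lie_bracket X Z)) \<alpha>"
    if "X \<in> \<V>" "Y \<in> \<V>" "Z \<in> \<V>" for X Y Z
    by (simp add: interior_lie_deriv[OF that(1,3) lie_deriv_in_cochains[OF that(2) \<alpha>]]
        interior_lie_deriv[OF that(2,3) \<alpha>]
        interior_lie_deriv[OF that(2) lie_bracket_vf[OF that(1,3)] \<alpha>]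
        lie_deriv_diff[OF that(1) lie_deriv_in_cochains[OF that(2) i] i])
  show ?case
  proof (rule cochain_eqI[OF lie_deriv_in_cochains[OF lie_bracket_vf[OF X Y] \<alpha>]
        cochains_closed(3)[OF lie_deriv_in_cochains[OF X lie_deriv_in_cochains[OF Y \<alpha>]]
          lie_deriv_in_cochains[OF Y lie_deriv_in_cochains[OF X \<alpha>]]]])
    show "interior Z (lie_deriv (lie_bracket X Y) \<alpha>)
        = interior Z (lie_deriv X (lie_deriv Y \<alpha>) - lie_deriv Y (lie_deriv X \<alpha>))" if Z: "Z \<in> \<V>" for Z
      unfolding interior_diff two[OF X Y Z] two[OF Y X Z]
        interior_lie_deriv[OF lie_bracket_vf[OF X Y] Z \<alpha>] Suc.IH[OF X Y i]
        lie_bracket_jacobi[OF X Y Z]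
      by (simp add: interior_diff_left[OF \<alpha>] lie_bracket_vf X Y Z)
  qed
qed

abbreviation d :: "'a dform \<Rightarrow> 'a dform" where "d \<equiv> ext_deriv M"

lemma d_add:
  assumes "\<alpha> \<in> cochains k" "\<beta> \<in> cochains k"
  shows "d (\<alpha> + \<beta>) = d \<alpha> + d \<beta>"
proof
  fix Xs
  have "(Xs ! i) (\<alpha> Ys + \<beta> Ys) = (Xs ! i) (\<alpha> Ys) + (Xs ! i) (\<beta> Ys)"
    if "set Xs \<subseteq> \<V>" "i < length Xs" for i Ys
    using that assms cochain_smooth by (intro vf_add) auto
  then show "d (\<alpha> + \<beta>) Xs = (d \<alpha> + d \<beta>) Xs"
    by (simp add: ext_deriv_def scaleR_add_right sum.distrib)
qed

lemma d_scale:
  assumes "\<alpha> \<in> cochains k"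
  shows "d (c *\<^sub>R \<alpha>) = c *\<^sub>R d \<alpha>"
proof
  fix Xs
  have "(Xs ! i) (c *\<^sub>R \<alpha> Ys) = c *\<^sub>R (Xs ! i) (\<alpha> Ys)"
    if "set Xs \<subseteq> \<V>" "i < length Xs" for i Ys
    using that assms cochain_smooth by (intro vf_scale) auto
  then show "d (c *\<^sub>R \<alpha>) Xs = (c *\<^sub>R d \<alpha>) Xs"
    by (simp add: ext_deriv_def scaleR_sum_right scaleR_add_right mult.commute)
qed

lemma d_zero [simp]: "d 0 = 0"
  using d_scale[of 0 0 0] cochains_closed(1)[of 0] by (simp del: cochains.simps)

lemma d_diff:
  assumes "\<alpha> \<in> cochains k" "\<beta> \<in> cochains k"
  shows "d (\<alpha> - \<beta>) = d \<alpha> - d \<beta>"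
  using d_add[of \<alpha> k "(-1) *\<^sub>R \<beta>"] d_scale[of \<beta> k "-1"] assms
    cochains_closed(4)[of \<beta> k "-1"] by simp

lemma d_uminus:
  assumes "\<alpha> \<in> cochains k"
  shows "d (- \<alpha>) = - d \<alpha>"
  using d_scale[OF assms, of "-1"] by simp

lemma d_sum:
  assumes "\<And>i. i \<in> I \<Longrightarrow> f i \<in> cochains k"
  shows "d (\<Sum>i\<in>I. f i) = (\<Sum>i\<in>I. d (f i))"
  using assms
  by (induction I rule: infinite_finite_induct) (auto simp: d_add[of _ k] cochains_closed)

text \<open>
  Cartan's formula \<open>\<iota>\<^sub>X d = L\<^sub>X - d \<iota>\<^sub>X\<close>, by splitting off the first argument in the invariant formula for
  \<open>d\<close>. The terms with \<open>i = 0\<close> form \<open>L\<^sub>X \<alpha>\<close>; in the others the indices shift by one or, in the bracket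
  sum, \<open>X\<close> has to be moved past \<open>[X\<^sub>i, X\<^sub>j]\<close>, and either gives the minus sign. From here on \<open>d\<close> is only
  used through this recursion.
\<close>

lemma cartan:
  assumes X: "X \<in> \<V>" and \<alpha>: "\<alpha> \<in> cochains k"
  shows "interior X (d \<alpha>) = lie_deriv X \<alpha> - d (interior X \<alpha>)"
proof (intro ext)
  fix Xs x
  show "interior X (d \<alpha>) Xs x = (lie_deriv X \<alpha> - d (interior X \<alpha>)) Xs x"
  proof (cases "set Xs \<subseteq> \<V>")
    case True
    have upd: "\<alpha> (Xs[j := lie_bracket X (Xs ! j)]) = (-1) ^ j *\<^sub>R \<alpha> (lie_bracket X (Xs ! j) # omit j Xs)"
      if "j < length Xs" for j
      by (rule cochain_update[OF \<alpha> that])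
    show ?thesis
      using True X
      by (simp add: cochain_swap[OF \<alpha>, of _ X] interior_apply ext_deriv_def lie_deriv_def upd sum.lessThan_Suc_shift sum.distrib sum_negf sum_subtractf
          del: sum.lessThan_Suc)
  next
    case False
    then show ?thesis by (simp add: interior_apply ext_deriv_def lie_deriv_def)
  qed
qed

lemma d_Nil [simp]: "d \<alpha> [] = 0"
  by (simp add: ext_deriv_def)

lemma d_in_cochains: "\<alpha> \<in> cochains k \<Longrightarrow> d \<alpha> \<in> cochains (Suc k)"
proof (induction k arbitrary: \<alpha> rule: less_induct)
  case (less k)
  note \<alpha> = less.prems
  have out: "interior X (d \<alpha>) = 0" if "X \<notin> \<V>" for X
    using that by (simp add: interior_apply ext_deriv_def fun_eq_iff)
  have di: "d (interior X \<alpha>) \<in> cochains k" for X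
  proof (cases k)
    case 0
    with \<alpha> have "interior X \<alpha> = 0" by simp
    then show ?thesis by (simp add: cochains_closed del: cochains.simps)
  next
    case (Suc k')
    then have "k' < k" "interior X \<alpha> \<in> cochains k'"
      using interior_in_cochains[OF \<alpha>, of X] by simp_all
    from less.IH[OF this] Suc show ?thesis by blast
  qed
  have "interior X (d \<alpha>) \<in> cochains k" if "X \<in> \<V>" for X
    using cartan[OF that \<alpha>] di lie_deriv_in_cochains[OF that \<alpha>] by (simp add: cochains_closed)
  moreover have "interior X (interior X (d \<alpha>)) = 0" if "X \<in> \<V>" for X
    using cartan[OF that \<alpha>] cartan[OF that interior_in_cochains[OF \<alpha>]] that \<alpha>
    by (simp add: interior_diff interior_lie_deriv interior_twice interior_zero_left)
  moreover have "interior (X + Y) (d \<alpha>) = interior X (d \<alpha>) + interior Y (d \<alpha>)"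
    if "X \<in> \<V>" "Y \<in> \<V>" for X Y
    using that \<alpha> subspace_add[OF subspace_vector_fields that] interior_in_cochains[OF \<alpha>]
    by (simp add: cartan lie_deriv_add_left interior_add_left d_add[of _ "k - 1"])
  ultimately show ?case using out by simp
qed

text \<open>
  \<open>L\<^sub>X\<close> commutes with \<open>d\<close>: after contraction with \<open>Y\<close>, Cartan's formula reduces the claim to degree one
  less, with the two previous commutator relations.
\<close>

lemma lie_deriv_d:
  "X \<in> \<V> \<Longrightarrow> \<alpha> \<in> cochains k \<Longrightarrow> lie_deriv X (d \<alpha>) = d (lie_deriv X \<alpha>)"
proof (induction k arbitrary: \<alpha> rule: less_induct)
  case (less k)
  note X = less.prems(1) and \<alpha> = less.prems(2)
  have IH: "lie_deriv X (d (interior Y \<alpha>)) = d (lie_deriv X (interior Y \<alpha>))" for Y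
  proof (cases k)
    case 0
    with \<alpha> X show ?thesis by simp
  next
    case (Suc k')
    then have "k' < k" "interior Y \<alpha> \<in> cochains k'"
      using interior_in_cochains[OF \<alpha>, of Y] by simp_all
    from less.IH[OF this(1) X this(2)] show ?thesis .
  qed
  note d\<alpha> = d_in_cochains[OF \<alpha>] and L = lie_deriv_in_cochains[OF X \<alpha>]
    and i = interior_in_cochains[OF \<alpha>]
  have di: "d (interior Y \<alpha>) \<in> cochains k" for Y
    using d_in_cochains[OF i, of Y] \<alpha> by (cases k) (auto simp: cochains_closed smooth_closed)
  show ?case
  proof (rule cochain_eqI[OF lie_deriv_in_cochains[OF X d\<alpha>] d_in_cochains[OF L]])
    fix Y assume Y: "Y \<in> \<V>"
    have XY: "lie_bracket X Y \<in> \<V>" by (rule lie_bracket_vf[OF X Y])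
    have "interior Y (lie_deriv X (d \<alpha>))
        = lie_deriv X (lie_deriv Y \<alpha> - d (interior Y \<alpha>)) - interior (lie_bracket X Y) (d \<alpha>)"
      by (simp add: interior_lie_deriv[OF X Y d\<alpha>] cartan[OF Y \<alpha>])
    also have "\<dots> = lie_deriv X (lie_deriv Y \<alpha>) - d (lie_deriv X (interior Y \<alpha>))
        - lie_deriv (lie_bracket X Y) \<alpha> + d (interior (lie_bracket X Y) \<alpha>)"
      by (simp add: lie_deriv_diff[OF X lie_deriv_in_cochains[OF Y \<alpha>] di] IH cartan[OF XY \<alpha>])
    also have "\<dots> = lie_deriv Y (lie_deriv X \<alpha>) - d (interior Y (lie_deriv X \<alpha>))"
      by (simp add: lie_deriv_bracket[OF X Y \<alpha>] interior_lie_deriv[OF X Y \<alpha>]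
          d_diff[OF lie_deriv_in_cochains[OF X i] i])
    also have "\<dots> = interior Y (d (lie_deriv X \<alpha>))"
      by (simp add: cartan[OF Y L])
    finally show "interior Y (lie_deriv X (d \<alpha>)) = interior Y (d (lie_deriv X \<alpha>))" .
  qed
qed

text \<open>
  Since \<open>\<iota>\<^sub>X d d = L\<^sub>X d - d \<iota>\<^sub>X d = L\<^sub>X d - d L\<^sub>X + d d \<iota>\<^sub>X\<close>, the claim for \<open>\<alpha>\<close> follows from the one for \<open>\<iota>\<^sub>X \<alpha>\<close>.
\<close>

theorem d_d: "\<alpha> \<in> cochains k \<Longrightarrow> d (d \<alpha>) = 0"
proof (induction k arbitrary: \<alpha> rule: less_induct)
  case (less k)
  note \<alpha> = less.prems
  have IH: "d (d (interior X \<alpha>)) = 0" for X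
  proof (cases k)
    case 0
    with \<alpha> show ?thesis by simp
  next
    case (Suc k')
    then have "k' < k" "interior X \<alpha> \<in> cochains k'"
      using interior_in_cochains[OF \<alpha>, of X] by simp_all
    from less.IH[OF this] show ?thesis .
  qed
  have di: "d (interior Y \<alpha>) \<in> cochains k" for Y
    using d_in_cochains[OF interior_in_cochains[OF \<alpha>], of Y] \<alpha> by (cases k) (auto simp: cochains_closed smooth_closed)
  show ?case
  proof (rule cochain_eqI[OF d_in_cochains[OF d_in_cochains[OF \<alpha>]] subspace_0[OF subspace_cochains]])
    fix X assume X: "X \<in> \<V>"
    show "interior X (d (d \<alpha>)) = interior X 0"
      by (simp add: cartan[OF X d_in_cochains[OF \<alpha>]] cartan[OF X \<alpha>] lie_deriv_d[OF X \<alpha>]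
          d_diff[OF lie_deriv_in_cochains[OF X \<alpha>] di] IH)
  qed
qed

end

section \<open>Contractions of differential forms\<close>

lemma dform_apply:
  fixes \<alpha> \<beta> :: "'a dform"
  shows "(\<alpha> + \<beta>) Xs = \<alpha> Xs + \<beta> Xs" "(\<alpha> - \<beta>) Xs = \<alpha> Xs - \<beta> Xs" "(- \<alpha>) Xs = - \<alpha> Xs"
    "(c *\<^sub>R \<alpha>) Xs = c *\<^sub>R \<alpha> Xs" "(0 :: 'a dform) Xs = 0"
  by (simp_all add: fun_eq_iff)

lemmas pointwise = plus_fun_apply zero_fun_apply times_fun_apply minus_apply uminus_apply
  scaleR_fun_apply sum_fun_apply

text \<open>
  The identities from here on are between vectors in spaces of forms, not between values. The
  polymorphic pointwise rules would also rewrite sums of functions below the arguments of operators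
  such as \<open>d\<close>.
\<close>

declare pointwise [simp del]

lemma interior_sum: "interior X (\<Sum>i\<in>I. f i) = (\<Sum>i\<in>I. interior X (f i))"
  by (intro ext) (simp add: interior_apply pointwise)

lemma contraction_apply: "contraction vs \<alpha> Xs = \<alpha> (vs @ Xs)"
  unfolding contraction_def
  by (induction vs arbitrary: \<alpha>) (simp_all add: interior_apply)

lemma contraction_Nil [simp]: "contraction [] \<alpha> = \<alpha>"
  by (simp add: contraction_def)

lemma contraction_Cons: "contraction (v # vs) \<alpha> = contraction vs (interior v \<alpha>)"
  by (simp add: contraction_def)

lemma contraction_snoc: "contraction (vs @ [v]) \<alpha> = interior v (contraction vs \<alpha>)"
  by (simp add: contraction_def)

lemma contraction_uminus: "contraction vs (- \<alpha>) = - contraction vs \<alpha>"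
  by (simp add: fun_eq_iff contraction_apply pointwise)

lemma contraction_zero [simp]: "contraction vs 0 = 0"
  by (simp add: fun_eq_iff contraction_apply pointwise)

context smooth_mfd begin

lemma formsD:
  assumes "\<alpha> \<in> forms M k" "length Xs = k" "set Xs \<subseteq> \<V>"
  shows form_smooth: "\<alpha> Xs \<in> \<A>"
    and form_add: "i < k \<Longrightarrow> X \<in> \<V> \<Longrightarrow> Y \<in> \<V> \<Longrightarrow> \<alpha> (Xs[i := X + Y]) = \<alpha> (Xs[i := X]) + \<alpha> (Xs[i := Y])"
    and form_mult: "i < k \<Longrightarrow> X \<in> \<V> \<Longrightarrow> f \<in> \<A> \<Longrightarrow> \<alpha> (Xs[i := (\<lambda>g. f * X g)]) = f * \<alpha> (Xs[i := X])"
    and form_alt: "i < k \<Longrightarrow> j < k \<Longrightarrow> i \<noteq> j \<Longrightarrow> Xs ! i = Xs ! j \<Longrightarrow> \<alpha> Xs = 0"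
proof -
  have *: "\<alpha> Xs \<in> \<A> \<and>
      (\<forall>i<k. \<forall>X\<in>\<V>. \<forall>Y\<in>\<V>. \<alpha> (Xs[i := X + Y]) = \<alpha> (Xs[i := X]) + \<alpha> (Xs[i := Y])) \<and>
      (\<forall>i<k. \<forall>X\<in>\<V>. \<forall>f\<in>\<A>. \<alpha> (Xs[i := (\<lambda>g. f * X g)]) = f * \<alpha> (Xs[i := X])) \<and>
      (\<forall>i<k. \<forall>j<k. i \<noteq> j \<and> Xs ! i = Xs ! j \<longrightarrow> \<alpha> Xs = 0)"
    by (rule assms(1)[unfolded forms_def mem_Collect_eq, THEN conjunct1, THEN spec, THEN mp,
          OF conjI[OF assms(2,3)]])
  show "\<alpha> Xs \<in> \<A>" using * by (rule conjunct1)
  show "\<alpha> (Xs[i := X + Y]) = \<alpha> (Xs[i := X]) + \<alpha> (Xs[i := Y])" if "i < k" "X \<in> \<V>" "Y \<in> \<V>"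
    using *[THEN conjunct2, THEN conjunct1, rule_format, OF that] .
  show "\<alpha> (Xs[i := (\<lambda>g. f * X g)]) = f * \<alpha> (Xs[i := X])" if "i < k" "X \<in> \<V>" "f \<in> \<A>"
    using *[THEN conjunct2, THEN conjunct2, THEN conjunct1, rule_format, OF that] .
  show "\<alpha> Xs = 0" if "i < k" "j < k" "i \<noteq> j" "Xs ! i = Xs ! j"
    using *[THEN conjunct2, THEN conjunct2, THEN conjunct2, rule_format, OF that(1,2)] that(3,4) by blast
qed

lemma form_outside: "\<alpha> \<in> forms M k \<Longrightarrow> \<not> (length Xs = k \<and> set Xs \<subseteq> \<V>) \<Longrightarrow> \<alpha> Xs = 0"
  unfolding forms_def mem_Collect_eq by (elim conjE) (erule allE[of _ Xs], erule (1) mp)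

lemma formsI:
  assumes "\<And>Xs. length Xs = k \<Longrightarrow> set Xs \<subseteq> \<V> \<Longrightarrow> \<alpha> Xs \<in> \<A>"
    and "\<And>Xs i X Y. length Xs = k \<Longrightarrow> set Xs \<subseteq> \<V> \<Longrightarrow> i < k \<Longrightarrow> X \<in> \<V> \<Longrightarrow> Y \<in> \<V> \<Longrightarrow>
      \<alpha> (Xs[i := X + Y]) = \<alpha> (Xs[i := X]) + \<alpha> (Xs[i := Y])"
    and "\<And>Xs i X f. length Xs = k \<Longrightarrow> set Xs \<subseteq> \<V> \<Longrightarrow> i < k \<Longrightarrow> X \<in> \<V> \<Longrightarrow> f \<in> \<A> \<Longrightarrow>
      \<alpha> (Xs[i := (\<lambda>g. f * X g)]) = f * \<alpha> (Xs[i := X])"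
    and "\<And>Xs i j. length Xs = k \<Longrightarrow> set Xs \<subseteq> \<V> \<Longrightarrow> i < k \<Longrightarrow> j < k \<Longrightarrow> i \<noteq> j \<Longrightarrow>
      Xs ! i = Xs ! j \<Longrightarrow> \<alpha> Xs = 0"
    and "\<And>Xs. \<not> (length Xs = k \<and> set Xs \<subseteq> \<V>) \<Longrightarrow> \<alpha> Xs = 0"
  shows "\<alpha> \<in> forms M k"
  unfolding forms_def mem_Collect_eq
  by (intro conjI allI ballI impI; (elim conjE)?; rule assms; assumption)

lemma interior_in_forms:
  assumes \<alpha>: "\<alpha> \<in> forms M (Suc k)" and X: "X \<in> \<V>"
  shows "interior X \<alpha> \<in> forms M k"
proof (rule formsI; unfold interior_apply)
  fix Xs assume Xs: "length Xs = k" "set Xs \<subseteq> \<V>"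
  have l: "length (X # Xs) = Suc k" "set (X # Xs) \<subseteq> \<V>"
    using Xs X by auto
  show "\<alpha> (X # Xs) \<in> \<A>"
    by (rule form_smooth[OF \<alpha> l])
  fix i assume i: "i < k"
  show "\<alpha> (X # Xs[i := Y + Z]) = \<alpha> (X # Xs[i := Y]) + \<alpha> (X # Xs[i := Z])"
    if "Y \<in> \<V>" "Z \<in> \<V>" for Y Z
    using form_add[OF \<alpha> l, of "Suc i" Y Z] i that by simp
  show "\<alpha> (X # Xs[i := (\<lambda>g. f * Y g)]) = f * \<alpha> (X # Xs[i := Y])" if "Y \<in> \<V>" "f \<in> \<A>" for Y f
    using form_mult[OF \<alpha> l, of "Suc i" Y f] i that by simp
  show "\<alpha> (X # Xs) = 0" if "j < k" "i \<noteq> j" "Xs ! i = Xs ! j" for j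
    by (rule form_alt[OF \<alpha> l, of "Suc i" "Suc j"]) (use i that in simp_all)
next
  fix Xs assume "\<not> (length Xs = k \<and> set Xs \<subseteq> \<V>)"
  then show "\<alpha> (X # Xs) = 0"
    by (intro form_outside[OF \<alpha>]) auto
qed

lemma subspace_forms: "subspace (forms M k)"
proof (rule subspaceI)
  show "0 \<in> forms M k"
    by (rule formsI; unfold dform_apply; simp add: smooth_closed)
next
  fix \<alpha> \<beta> assume \<alpha>: "\<alpha> \<in> forms M k" and \<beta>: "\<beta> \<in> forms M k"
  show "\<alpha> + \<beta> \<in> forms M k"
  proof (rule formsI; unfold dform_apply)
    fix Xs assume l: "length Xs = k" "set Xs \<subseteq> \<V>"
    show "\<alpha> Xs + \<beta> Xs \<in> \<A>"
      by (intro smooth_closed form_smooth[OF \<alpha> l] form_smooth[OF \<beta> l])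
    fix i assume i: "i < k"
    show "\<alpha> (Xs[i := X + Y]) + \<beta> (Xs[i := X + Y])
        = \<alpha> (Xs[i := X]) + \<beta> (Xs[i := X]) + (\<alpha> (Xs[i := Y]) + \<beta> (Xs[i := Y]))"
      if "X \<in> \<V>" "Y \<in> \<V>" for X Y
      by (simp only: form_add[OF \<alpha> l i that] form_add[OF \<beta> l i that] ac_simps)
    show "\<alpha> (Xs[i := (\<lambda>g. f * X g)]) + \<beta> (Xs[i := (\<lambda>g. f * X g)])
        = f * (\<alpha> (Xs[i := X]) + \<beta> (Xs[i := X]))" if "X \<in> \<V>" "f \<in> \<A>" for X f
      by (simp only: form_mult[OF \<alpha> l i that] form_mult[OF \<beta> l i that] distrib_left)
    show "\<alpha> Xs + \<beta> Xs = 0" if "j < k" "i \<noteq> j" "Xs ! i = Xs ! j" for j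
      by (simp only: form_alt[OF \<alpha> l i that] form_alt[OF \<beta> l i that] add_0)
  next
    fix Xs assume "\<not> (length Xs = k \<and> set Xs \<subseteq> \<V>)"
    then show "\<alpha> Xs + \<beta> Xs = 0"
      by (simp only: form_outside[OF \<alpha>] form_outside[OF \<beta>] add_0 simp_thms)
  qed
next
  fix c \<alpha> assume \<alpha>: "\<alpha> \<in> forms M k"
  show "c *\<^sub>R \<alpha> \<in> forms M k"
  proof (rule formsI; unfold dform_apply)
    fix Xs assume l: "length Xs = k" "set Xs \<subseteq> \<V>"
    show "c *\<^sub>R \<alpha> Xs \<in> \<A>"
      by (intro smooth_closed form_smooth[OF \<alpha> l])
    fix i assume i: "i < k"
    show "c *\<^sub>R \<alpha> (Xs[i := X + Y]) = c *\<^sub>R \<alpha> (Xs[i := X]) + c *\<^sub>R \<alpha> (Xs[i := Y])"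
      if "X \<in> \<V>" "Y \<in> \<V>" for X Y
      by (simp only: form_add[OF \<alpha> l i that] scaleR_add_right)
    show "c *\<^sub>R \<alpha> (Xs[i := (\<lambda>g. f * X g)]) = f * c *\<^sub>R \<alpha> (Xs[i := X])" if "X \<in> \<V>" "f \<in> \<A>" for X f
      by (simp add: form_mult[OF \<alpha> l i that] fun_eq_iff pointwise)
    show "c *\<^sub>R \<alpha> Xs = 0" if "j < k" "i \<noteq> j" "Xs ! i = Xs ! j" for j
      by (simp only: form_alt[OF \<alpha> l i that] scaleR_zero_right)
  next
    fix Xs assume "\<not> (length Xs = k \<and> set Xs \<subseteq> \<V>)"
    then show "c *\<^sub>R \<alpha> Xs = 0"
      by (simp only: form_outside[OF \<alpha>] scaleR_zero_right simp_thms)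
  qed
qed

text \<open>
  Real homogeneity in a vector field argument is linearity over the constant functions. It is
  stated for forms because a cochain is only additive in its arguments.
\<close>

lemma interior_scale_left:
  assumes "\<alpha> \<in> forms M k" "X \<in> \<V>"
  shows "interior (c *\<^sub>R X) \<alpha> = c *\<^sub>R interior X \<alpha>"
proof
  fix Xs
  have cX: "c *\<^sub>R X \<in> \<V>" using assms(2) by (rule subspace_scale[OF subspace_vector_fields])
  show "interior (c *\<^sub>R X) \<alpha> Xs = (c *\<^sub>R interior X \<alpha>) Xs"
  proof (cases "length (X # Xs) = k \<and> set (X # Xs) \<subseteq> \<V>")
    case True
    have "(\<lambda>g. (\<lambda>_. c) * X g) = c *\<^sub>R X"
      by (simp add: fun_eq_iff pointwise)
    moreover have "(\<lambda>_. c) * \<alpha> (X # Xs) = c *\<^sub>R \<alpha> (X # Xs)"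
      by (simp add: fun_eq_iff pointwise)
    ultimately show ?thesis
      using form_mult[OF assms(1) conjunct1[OF True] conjunct2[OF True], of 0 X "\<lambda>_. c"] True assms(2)
        const_smooth[of c]
      unfolding interior_apply dform_apply by fastforce
  next
    case False
    then have "\<not> (length (c *\<^sub>R X # Xs) = k \<and> set (c *\<^sub>R X # Xs) \<subseteq> \<V>)"
      using cX assms(2) by auto
    from form_outside[OF assms(1) this] form_outside[OF assms(1) False] show ?thesis
      unfolding interior_apply dform_apply by (simp only: scaleR_zero_right)
  qed
qed

lemma forms_in_cochains: "\<alpha> \<in> forms M k \<Longrightarrow> \<alpha> \<in> cochains k"
proof (induction k arbitrary: \<alpha>)
  case 0
  have "interior X \<alpha> = 0" for X
  proof
    fix Xs show "interior X \<alpha> Xs = 0 Xs"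
      unfolding interior_apply dform_apply by (rule form_outside[OF 0]) simp
  qed
  with form_smooth[OF 0, of "[]"] show ?case by simp
next
  case (Suc k)
  note \<alpha> = Suc.prems
  have "\<alpha> [] = 0"
    by (rule form_outside[OF \<alpha>]) simp
  moreover have "interior X \<alpha> = 0" if "X \<notin> \<V>" for X
  proof
    fix Xs show "interior X \<alpha> Xs = 0 Xs"
      unfolding interior_apply dform_apply by (rule form_outside[OF \<alpha>]) (use that in simp)
  qed
  moreover have "interior X (interior X \<alpha>) = 0" for X
  proof
    fix Xs
    have "\<alpha> (X # X # Xs) = 0"
    proof (cases "length (X # X # Xs) = Suc k \<and> set (X # X # Xs) \<subseteq> \<V>")
      case True
      then show ?thesis
        using form_alt[OF \<alpha>, of "X # X # Xs" 0 1] by simp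
    qed (rule form_outside[OF \<alpha>])
    then show "interior X (interior X \<alpha>) Xs = 0 Xs"
      unfolding interior_apply dform_apply .
  qed
  moreover have "interior (X + Y) \<alpha> = interior X \<alpha> + interior Y \<alpha>" if "X \<in> \<V>" "Y \<in> \<V>" for X Y
  proof
    fix Xs
    have XY: "X + Y \<in> \<V>" using that by (rule subspace_add[OF subspace_vector_fields])
    show "interior (X + Y) \<alpha> Xs = (interior X \<alpha> + interior Y \<alpha>) Xs"
    proof (cases "length Xs = k \<and> set Xs \<subseteq> \<V>")
      case True
      then show ?thesis
        using form_add[OF \<alpha>, of "X # Xs" 0 X Y] that unfolding interior_apply dform_apply
        by simp
    next
      case False
      have "\<alpha> (Z # Xs) = 0" for Z
        by (rule form_outside[OF \<alpha>]) (use False in auto)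
      then show ?thesis unfolding interior_apply dform_apply by (simp only: add_0)
    qed
  qed
  ultimately show ?case
    using Suc.IH interior_in_forms[OF \<alpha>] by simp
qed

lemma contraction_in_cochains:
  "\<alpha> \<in> cochains k \<Longrightarrow> contraction vs \<alpha> \<in> cochains (k - length vs)"
proof (induction vs arbitrary: \<alpha> k)
  case (Cons v vs)
  from Cons.IH[OF interior_in_cochains[OF Cons.prems]] show ?case
    by (simp add: contraction_Cons)
qed simp

lemma contraction_in_forms:
  "\<alpha> \<in> forms M k \<Longrightarrow> set vs \<subseteq> \<V> \<Longrightarrow> length vs \<le> k \<Longrightarrow> contraction vs \<alpha> \<in> forms M (k - length vs)"
proof (induction vs arbitrary: \<alpha> k)
  case (Cons v vs)
  then obtain k' where k: "k = Suc k'" by (cases k) auto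
  have "interior v \<alpha> \<in> forms M k'"
    using Cons.prems interior_in_forms k by simp
  from Cons.IH[OF this] Cons.prems k show ?case
    by (simp add: contraction_Cons)
qed simp

lemma contraction_eq_zero:
  assumes "\<alpha> \<in> forms M k" "k < length vs"
  shows "contraction vs \<alpha> = 0"
proof
  fix Xs show "contraction vs \<alpha> Xs = 0 Xs"
    unfolding contraction_apply dform_apply
    by (rule form_outside[OF assms(1)]) (use assms(2) in simp)
qed

lemma contraction_to_front:
  assumes "\<alpha> \<in> cochains k"
  shows "contraction (us @ v # vs) \<alpha> = (-1) ^ length us *\<^sub>R contraction (us @ vs) (interior v \<alpha>)"
  by (intro ext) (simp add: contraction_apply pointwise interior_apply cochain_to_front[OF assms])

lemma contraction_swap:
  assumes "\<alpha> \<in> cochains k"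
  shows "contraction (us @ v # w # vs) \<alpha> = - contraction (us @ w # v # vs) \<alpha>"
  using assms
proof (induction us arbitrary: \<alpha> k)
  case Nil
  then show ?case
    by (simp add: contraction_Cons interior_anti[OF Nil, of w v] fun_eq_iff contraction_apply pointwise)
next
  case (Cons u us)
  from Cons.IH[OF interior_in_cochains[OF Cons.prems]] show ?case
    by (simp add: contraction_Cons)
qed

text \<open>
  The iterated form of \<open>[L\<^sub>v, \<iota>\<^sub>u] = \<iota>\<^bsub>[v,u]\<^esub>\<close>. Contraction with a list ends with its last entry, so the
  induction removes entries from the end.
\<close>

lemma lie_deriv_contraction:
  assumes v: "v \<in> \<V>" and \<alpha>: "\<alpha> \<in> cochains k"
  shows "set vs \<subseteq> \<V> \<Longrightarrow> lie_deriv v (contraction vs \<alpha>) = contraction vs (lie_deriv v \<alpha>)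
    + (\<Sum>i<length vs. (-1) ^ i *\<^sub>R contraction (lie_bracket v (vs ! i) # omit i vs) \<alpha>)"
proof (induction vs rule: rev_induct)
  case (snoc u us)
  then have u: "u \<in> \<V>" and us: "set us \<subseteq> \<V>" by auto
  have "lie_deriv v (contraction (us @ [u]) \<alpha>)
      = interior u (lie_deriv v (contraction us \<alpha>)) + interior (lie_bracket v u) (contraction us \<alpha>)"
    using interior_lie_deriv[OF v u contraction_in_cochains[OF \<alpha>, of us]]
    by (simp add: contraction_snoc)
  also have "interior u (lie_deriv v (contraction us \<alpha>)) = contraction (us @ [u]) (lie_deriv v \<alpha>)
      + (\<Sum>i<length us. (-1) ^ i *\<^sub>R contraction (lie_bracket v ((us @ [u]) ! i) # omit i (us @ [u])) \<alpha>)"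
    unfolding snoc.IH[OF us] interior_add interior_sum interior_scale contraction_snoc[symmetric]
    by (intro arg_cong2[where f="(+)"] sum.cong refl) (simp add: nth_append omit_append)
  also have "interior (lie_bracket v u) (contraction us \<alpha>)
      = (-1) ^ length us *\<^sub>R contraction (lie_bracket v u # us) \<alpha>"
    using contraction_to_front[OF \<alpha>, of us "lie_bracket v u" "[]"]
    by (simp add: contraction_snoc contraction_Cons)
  finally show ?case
    by (simp add: omit_append add.assoc)
qed simp

end

section \<open>Hamiltonian vector fields and brackets of Hamiltonian forms\<close>

text \<open>
  The Chevalley-Eilenberg boundary of \<open>v\<^sub>1 \<and> \<dots> \<and> v\<^sub>m\<close>, contracted into \<open>\<omega>\<close>.
\<close>

definition bracket_contractions :: "'a dform \<Rightarrow> 'a vfield list \<Rightarrow> 'a dform" where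
  "bracket_contractions \<omega> vs = (\<Sum>b<length vs. \<Sum>a<b.
     (-1) ^ (a + b) *\<^sub>R contraction (lie_bracket (vs ! a) (vs ! b) # omit a (omit b vs)) \<omega>)"

locale pre_plectic_mfd = smooth_mfd +
  fixes n :: nat and \<omega> :: "'a dform"
  assumes n_pos: "n \<ge> 1" and pre_plectic: "pre_plectic M n \<omega>"
begin

lemma \<omega>_form: "\<omega> \<in> forms M (n + 1)" and d\<omega>: "d \<omega> = 0"
  using pre_plectic by (auto simp: pre_plectic_def)

lemma \<omega>_cochain: "\<omega> \<in> cochains (n + 1)"
  by (rule forms_in_cochains[OF \<omega>_form])

abbreviation "ham_vf \<equiv> ham_vector_field M \<omega>"
abbreviation "\<H> \<equiv> ham_forms M n \<omega>"

lemma ham_formD: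
  assumes "\<alpha> \<in> \<H>"
  shows ham_form_cochain: "\<alpha> \<in> cochains (n - 1)"
    and some_ham_vf: "ham_vf \<alpha> (some_ham_vf M \<omega> \<alpha>)"
  using assms someI_ex[of "ham_vf \<alpha>"]
  by (auto simp: ham_forms_def some_ham_vf_def intro: forms_in_cochains)

lemma ham_vfD: "ham_vf \<alpha> v \<Longrightarrow> v \<in> \<V>" "ham_vf \<alpha> v \<Longrightarrow> d \<alpha> = - interior v \<omega>"
  by (auto simp: ham_vector_field_def)

text \<open>
  Hamiltonian vector fields preserve \<open>\<omega>\<close>: \<open>L\<^sub>v \<omega> = \<iota>\<^sub>v d \<omega> + d \<iota>\<^sub>v \<omega> = - d d \<alpha> = 0\<close>.
\<close>

lemma lie_deriv_ham_vf:
  assumes "\<alpha> \<in> \<H>" "ham_vf \<alpha> v"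
  shows "lie_deriv v \<omega> = 0"
proof -
  have "d (interior v \<omega>) = d (- d \<alpha>)"
    using ham_vfD(2)[OF assms(2)] by simp
  also have "\<dots> = 0"
    using d_uminus[OF d_in_cochains[OF ham_form_cochain[OF assms(1)]]] d_d[OF ham_form_cochain[OF assms(1)]]
    by simp
  finally show ?thesis
    using cartan[OF ham_vfD(1)[OF assms(2)] \<omega>_cochain] by (simp add: d\<omega>)
qed

text \<open>
  The key computation. For vector fields that preserve a closed \<open>\<omega>\<close>, the differential of
  \<open>\<iota>(v\<^sub>1 \<and> \<dots> \<and> v\<^sub>m) \<omega>\<close> is, up to sign, the contraction with the Chevalley-Eilenberg boundary. Adding a
  last field \<open>v\<close> and using Cartan's formula, \<open>L\<^sub>v\<close> yields the brackets \<open>[v, v\<^sub>i]\<close>, and \<open>\<iota>\<^sub>v d\<close> yields all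
  brackets of earlier fields by the induction hypothesis.
\<close>

lemma d_contraction:
  "set vs \<subseteq> \<V> \<Longrightarrow> (\<And>v. v \<in> set vs \<Longrightarrow> lie_deriv v \<omega> = 0) \<Longrightarrow>
    d (contraction vs \<omega>) = (-1) ^ length vs *\<^sub>R bracket_contractions \<omega> vs"
proof (induction vs rule: rev_induct)
  case Nil
  then show ?case by (simp add: d\<omega> bracket_contractions_def)
next
  case (snoc v vs)
  then have v: "v \<in> \<V>" and vs: "set vs \<subseteq> \<V>" by auto
  have L: "lie_deriv v \<omega> = 0"
    by (rule snoc.prems(2)) simp
  have IH: "d (contraction vs \<omega>) = (-1) ^ length vs *\<^sub>R bracket_contractions \<omega> vs"
    by (rule snoc.IH[OF vs], rule snoc.prems(2)) simp
  let ?l = "length vs"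
  let ?S = "\<Sum>i<?l. (-1) ^ i *\<^sub>R contraction (lie_bracket v (vs ! i) # omit i vs) \<omega>"
  have "d (contraction (vs @ [v]) \<omega>) = lie_deriv v (contraction vs \<omega>) - interior v (d (contraction vs \<omega>))"
    using cartan[OF v contraction_in_cochains[OF \<omega>_cochain]] by (simp add: contraction_snoc)
  also have "\<dots> = ?S - (-1) ^ ?l *\<^sub>R interior v (bracket_contractions \<omega> vs)"
    unfolding lie_deriv_contraction[OF v \<omega>_cochain vs] L IH interior_scale contraction_zero add_0 ..
  also have "interior v (bracket_contractions \<omega> vs) = (\<Sum>b<?l. \<Sum>a<b. (-1) ^ (a + b) *\<^sub>R
      contraction (lie_bracket ((vs @ [v]) ! a) ((vs @ [v]) ! b) # omit a (omit b (vs @ [v]))) \<omega>)"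
    unfolding bracket_contractions_def interior_sum interior_scale
    by (intro sum.cong refl)
       (auto simp: nth_append omit_append length_omit contraction_Cons contraction_snoc)
  also have "?S = - ((-1) ^ ?l *\<^sub>R (\<Sum>a<?l. (-1) ^ (a + ?l) *\<^sub>R
      contraction (lie_bracket ((vs @ [v]) ! a) ((vs @ [v]) ! ?l) # omit a (omit ?l (vs @ [v]))) \<omega>))"
  proof -
    have anti: "contraction (lie_bracket v u # us) \<omega> = - contraction (lie_bracket u v # us) \<omega>"
      if "u \<in> \<V>" for u us
      unfolding contraction_Cons lie_bracket_anti[of v u]
        interior_uminus_left[OF \<omega>_cochain lie_bracket_vf[OF that v]] contraction_uminus ..
    have "(-1::real) ^ ?l * (-1) ^ (a + ?l) = (-1) ^ a" for a
      by (cases "even ?l"; cases "even a") simp_all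
    then have "(-1) ^ a *\<^sub>R \<beta> = (-1::real) ^ ?l *\<^sub>R (-1) ^ (a + ?l) *\<^sub>R \<beta>" for a and \<beta> :: "'a dform"
      by (simp only: scaleR_scaleR)
    moreover have "lie_bracket v (vs ! a) # omit a vs = lie_bracket v ((vs @ [v]) ! a) # omit a (omit ?l (vs @ [v]))"
      if "a < ?l" for a
      using that by (simp add: nth_append omit_append)
    moreover have "(vs @ [v]) ! a \<in> \<V>" "(vs @ [v]) ! ?l = v" if "a < ?l" for a
      using that vs by (auto simp: nth_append)
    ultimately show ?thesis
      unfolding scaleR_sum_right sum_negf[symmetric]
      by (intro sum.cong refl) (simp only: lessThan_iff anti scaleR_minus_right)
  qed
  finally show ?case
    by (simp add: bracket_contractions_def scaleR_add_right)
qed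

text \<open>
  Contraction with a list depends only on the forms \<open>\<iota>\<^sub>v \<omega>\<close> of its entries, since each entry can be moved
  to the front. The prefix \<open>us\<close> holds the entries that have already been exchanged.
\<close>

lemma contraction_ham_vf_unique:
  "list_all2 (\<lambda>v w. interior v \<omega> = interior w \<omega>) vs ws \<Longrightarrow>
    contraction (us @ vs) \<omega> = contraction (us @ ws) \<omega>"
proof (induction vs ws arbitrary: us rule: list_all2_induct)
  case (Cons v vs w ws)
  have "contraction (us @ v # vs) \<omega> = contraction ((us @ [w]) @ vs) \<omega>"
    using Cons by (simp add: contraction_to_front[OF \<omega>_cochain])
  with Cons.IH[of "us @ [w]"] show ?case by simp
qed simp

abbreviation "hbracket \<equiv> ham_bracket M \<omega>"

text \<open>
  All Hamiltonian vector fields of \<open>\<alpha>\<close> have the same contraction \<open>- d \<alpha>\<close> with \<open>\<omega>\<close>, so the bracket may be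
  computed with any choice of them.
\<close>

lemma ham_bracket_eq:
  assumes "set \<alpha>s \<subseteq> \<H>" "list_all2 ham_vf \<alpha>s vs"
  shows "hbracket \<alpha>s = varsigma (length \<alpha>s) *\<^sub>R contraction vs \<omega>"
proof -
  have "list_all2 (\<lambda>v w. interior v \<omega> = interior w \<omega>) (map (some_ham_vf M \<omega>) \<alpha>s) vs"
    using assms(2,1)
  proof (induction rule: list_all2_induct)
    case (Cons \<alpha> \<alpha>s v vs)
    have "- interior (some_ham_vf M \<omega> \<alpha>) \<omega> = - interior v \<omega>"
      using ham_vfD(2)[OF Cons(1)] ham_vfD(2)[OF some_ham_vf] Cons.prems by simp
    then have "interior (some_ham_vf M \<omega> \<alpha>) \<omega> = interior v \<omega>"
      by (simp only: neg_equal_iff_equal)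
    with Cons show ?case by simp
  qed simp
  from contraction_ham_vf_unique[OF this, of "[]"] show ?thesis
    by (simp add: ham_bracket_def)
qed

lemma list_all2_some_ham_vf:
  "set \<alpha>s \<subseteq> \<H> \<Longrightarrow> list_all2 ham_vf \<alpha>s (map (some_ham_vf M \<omega>) \<alpha>s)"
  by (induction \<alpha>s) (auto simp: some_ham_vf)

lemma some_ham_vf_in: "set \<alpha>s \<subseteq> \<H> \<Longrightarrow> set (map (some_ham_vf M \<omega>) \<alpha>s) \<subseteq> \<V>"
  using some_ham_vf ham_vfD(1) by fastforce

lemma ham_bracket_cochain:
  "set \<alpha>s \<subseteq> \<H> \<Longrightarrow> hbracket \<alpha>s \<in> cochains (n + 1 - length \<alpha>s)"
  unfolding ham_bracket_def
  using contraction_in_cochains[OF \<omega>_cochain, of "map (some_ham_vf M \<omega>) \<alpha>s"]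
  by (intro cochains_closed) simp

lemma ham_vf_add:
  assumes "\<alpha> \<in> \<H>" "\<beta> \<in> \<H>" "ham_vf \<alpha> v" "ham_vf \<beta> w"
  shows "ham_vf (\<alpha> + \<beta>) (v + w)"
  using ham_vfD[OF assms(3)] ham_vfD[OF assms(4)] subspace_add[OF subspace_vector_fields]
    d_add[OF ham_form_cochain[OF assms(1)] ham_form_cochain[OF assms(2)]]
  by (simp add: ham_vector_field_def interior_add_left[OF \<omega>_cochain])

lemma ham_vf_scale:
  assumes "\<alpha> \<in> \<H>" "ham_vf \<alpha> v"
  shows "ham_vf (c *\<^sub>R \<alpha>) (c *\<^sub>R v)"
  using ham_vfD[OF assms(2)] subspace_scale[OF subspace_vector_fields]
    d_scale[OF ham_form_cochain[OF assms(1)]]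
  by (simp add: ham_vector_field_def interior_scale_left[OF \<omega>_form])

lemma subspace_ham_forms: "subspace \<H>"
proof (rule subspaceI)
  have "ham_vf 0 0"
    using subspace_0[OF subspace_vector_fields]
    by (simp add: ham_vector_field_def interior_zero_left[OF \<omega>_cochain])
  then show "0 \<in> \<H>"
    using subspace_0[OF subspace_forms] by (auto simp: ham_forms_def)
next
  fix \<alpha> \<beta> assume "\<alpha> \<in> \<H>" "\<beta> \<in> \<H>"
  then obtain v w where v: "ham_vf \<alpha> v" and w: "ham_vf \<beta> w"
    using some_ham_vf by blast
  from ham_vf_add[OF \<open>\<alpha> \<in> \<H>\<close> \<open>\<beta> \<in> \<H>\<close> v w] show "\<alpha> + \<beta> \<in> \<H>"
    using subspace_add[OF subspace_forms] \<open>\<alpha> \<in> \<H>\<close> \<open>\<beta> \<in> \<H>\<close> by (auto simp: ham_forms_def)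
next
  fix c \<alpha> assume "\<alpha> \<in> \<H>"
  then obtain v where v: "ham_vf \<alpha> v"
    using some_ham_vf by blast
  from ham_vf_scale[OF \<open>\<alpha> \<in> \<H>\<close> v] show "c *\<^sub>R \<alpha> \<in> \<H>"
    using subspace_scale[OF subspace_forms] \<open>\<alpha> \<in> \<H>\<close> by (auto simp: ham_forms_def)
qed

text \<open>
  Isolates the dependence on one argument; linearity of the bracket in that argument and its
  vanishing on closed arguments are read off from the last factor.
\<close>

lemma ham_bracket_slot:
  assumes "set (us @ vs) \<subseteq> \<H>" "\<alpha> \<in> \<H>" "ham_vf \<alpha> v"
  shows "hbracket (us @ \<alpha> # vs) = (varsigma (length us + length vs + 1) * (-1) ^ length us) *\<^sub>R
    contraction (map (some_ham_vf M \<omega>) (us @ vs)) (interior v \<omega>)"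
proof -
  let ?h = "map (some_ham_vf M \<omega>)"
  have "list_all2 ham_vf (us @ \<alpha> # vs) (?h us @ v # ?h vs)"
    using assms list_all2_some_ham_vf by (auto intro!: list_all2_appendI)
  then have "hbracket (us @ \<alpha> # vs)
      = varsigma (length us + length vs + 1) *\<^sub>R contraction (?h us @ v # ?h vs) \<omega>"
    using ham_bracket_eq[of "us @ \<alpha> # vs"] assms by simp
  then show ?thesis
    by (simp add: contraction_to_front[OF \<omega>_cochain])
qed

lemma contraction_add: "contraction vs (\<alpha> + \<beta>) = contraction vs \<alpha> + contraction vs \<beta>"
  and contraction_scale: "contraction vs (c *\<^sub>R \<alpha>) = c *\<^sub>R contraction vs \<alpha>"
  by (intro ext; simp add: contraction_apply pointwise)+

lemma ham_bracket_add:
  assumes "set (us @ vs) \<subseteq> \<H>" "\<alpha> \<in> \<H>" "\<beta> \<in> \<H>"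
  shows "hbracket (us @ (\<alpha> + \<beta>) # vs) = hbracket (us @ \<alpha> # vs) + hbracket (us @ \<beta> # vs)"
proof -
  obtain v w where v: "ham_vf \<alpha> v" and w: "ham_vf \<beta> w"
    using some_ham_vf assms by blast
  show ?thesis
    using ham_vfD[OF v] ham_vfD[OF w]
    by (simp add: ham_bracket_slot[OF assms(1) assms(2) v] ham_bracket_slot[OF assms(1) assms(3) w]
        ham_bracket_slot[OF assms(1) subspace_add[OF subspace_ham_forms assms(2,3)] ham_vf_add[OF assms(2,3) v w]]
        interior_add_left[OF \<omega>_cochain] contraction_add scaleR_add_right)
qed

lemma ham_bracket_scale:
  assumes "set (us @ vs) \<subseteq> \<H>" "\<alpha> \<in> \<H>"
  shows "hbracket (us @ (c *\<^sub>R \<alpha>) # vs) = c *\<^sub>R hbracket (us @ \<alpha> # vs)"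
proof -
  obtain v where v: "ham_vf \<alpha> v"
    using some_ham_vf assms by blast
  show ?thesis
    using ham_vfD[OF v]
    by (simp add: ham_bracket_slot[OF assms(1) assms(2) v]
        ham_bracket_slot[OF assms(1) subspace_scale[OF subspace_ham_forms assms(2)] ham_vf_scale[OF assms(2) v]]
        interior_scale_left[OF \<omega>_form] contraction_scale mult.commute mult.left_commute)
qed

text \<open>
  A closed form has the Hamiltonian vector field \<open>0\<close>. This kills the nested brackets in which the
  differential of a bracket appears as an argument.
\<close>

lemma ham_bracket_closed:
  assumes "set (us @ vs) \<subseteq> \<H>" "\<alpha> \<in> \<H>" "d \<alpha> = 0"
  shows "hbracket (us @ \<alpha> # vs) = 0"
proof -
  have "ham_vf \<alpha> 0"
    using assms(3) subspace_0[OF subspace_vector_fields]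
    by (simp add: ham_vector_field_def interior_zero_left[OF \<omega>_cochain])
  from ham_bracket_slot[OF assms(1,2) this] show ?thesis
    by (simp add: interior_zero_left[OF \<omega>_cochain])
qed

lemma ham_bracket_swap:
  "hbracket (us @ \<alpha> # \<beta> # vs) = - hbracket (us @ \<beta> # \<alpha> # vs)"
  by (simp add: ham_bracket_def contraction_swap[OF \<omega>_cochain, of _ "some_ham_vf M \<omega> \<alpha>"])

text \<open>
  The sign choice that makes the Jacobi identities work: it absorbs the factor \<open>(-1)\<^sup>m\<close> of
  the differential of an \<open>m\<close>-fold contraction.
\<close>

lemma varsigma_Suc: "varsigma (Suc k) * (-1) ^ Suc k = varsigma k"
proof -
  have "Suc k * (Suc k + 1) div 2 = k * (k + 1) div 2 + Suc k"
  proof -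
    have "Suc k * (Suc k + 1) = k * (k + 1) + 2 * Suc k" by (simp add: algebra_simps)
    then show ?thesis by simp
  qed
  then show ?thesis
    by (simp add: varsigma_def power_add)
qed

text \<open>
  The binary bracket corresponds to the Lie bracket of vector fields: this is the case \<open>m = 2\<close> of the
  formula for the differential of a contraction.
\<close>

lemma ham_bracket_pair:
  assumes "\<alpha> \<in> \<H>" "\<beta> \<in> \<H>" "ham_vf \<alpha> v" "ham_vf \<beta> w"
  shows "hbracket [\<alpha>, \<beta>] \<in> \<H>" "ham_vf (hbracket [\<alpha>, \<beta>]) (lie_bracket v w)"
proof -
  have V: "v \<in> \<V>" "w \<in> \<V>" using assms ham_vfD(1) by auto
  have eq: "hbracket [\<alpha>, \<beta>] = contraction [v, w] \<omega>"
    using ham_bracket_eq[of "[\<alpha>, \<beta>]" "[v, w]"] assms by (simp add: varsigma_def)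
  have "lie_deriv u \<omega> = 0" if "u \<in> set [v, w]" for u
    using that lie_deriv_ham_vf assms by auto
  then have "d (contraction [v, w] \<omega>) = bracket_contractions \<omega> [v, w]"
    using d_contraction[of "[v, w]"] V by simp
  also have "\<dots> = - interior (lie_bracket v w) \<omega>"
    by (simp add: bracket_contractions_def numeral_2_eq_2 contraction_Cons)
  finally show h: "ham_vf (hbracket [\<alpha>, \<beta>]) (lie_bracket v w)"
    by (simp add: ham_vector_field_def eq lie_bracket_vf V)
  have "contraction [v, w] \<omega> \<in> forms M (n - 1)"
    using contraction_in_forms[OF \<omega>_form, of "[v, w]"] V n_pos by simp
  with h show "hbracket [\<alpha>, \<beta>] \<in> \<H>"
    by (auto simp: ham_forms_def eq)
qed

lemma set_omit2: "set (omit a (omit b xs)) \<subseteq> set xs"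
  by (meson order_trans set_omit_subset)

lemma omit_map: "omit i (map f xs) = map f (omit i xs)"
  by (simp add: omit_def take_map drop_map)

text \<open>
  The differential of the formula for the \<open>m\<close>-ary bracket: each \<open>[v\<^sub>a, v\<^sub>b]\<close> is a Hamiltonian vector field of
  the bracket of \<open>\<alpha>\<^sub>a\<close> and \<open>\<alpha>\<^sub>b\<close>, so the right-hand side consists of nested brackets. This is the Jacobi
  identity for arguments of degree \<open>0\<close> in disguise.
\<close>

lemma d_ham_bracket:
  assumes "set \<alpha>s \<subseteq> \<H>" 
  shows "d (hbracket \<alpha>s) = (\<Sum>b<length \<alpha>s. \<Sum>a<b. (-1) ^ (a + b) *\<^sub>R
    hbracket (hbracket [\<alpha>s ! a, \<alpha>s ! b] # omit a (omit b \<alpha>s)))"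
proof -
  let ?v = "some_ham_vf M \<omega>" and ?m = "length \<alpha>s"
  have L: "lie_deriv v \<omega> = 0" if "v \<in> set (map ?v \<alpha>s)" for v
  proof -
    from that obtain \<alpha> where "\<alpha> \<in> set \<alpha>s" "v = ?v \<alpha>" by auto
    with assms show ?thesis using lie_deriv_ham_vf[OF _ some_ham_vf] by blast
  qed
  have "d (hbracket \<alpha>s) = varsigma ?m *\<^sub>R d (contraction (map ?v \<alpha>s) \<omega>)"
    unfolding ham_bracket_def by (rule d_scale[OF contraction_in_cochains[OF \<omega>_cochain]])
  also have "\<dots> = (varsigma ?m * (-1) ^ ?m) *\<^sub>R bracket_contractions \<omega> (map ?v \<alpha>s)"
    using d_contraction[OF some_ham_vf_in[OF assms] L] by simp
  also have "\<dots> = (\<Sum>b<?m. \<Sum>a<b. (-1) ^ (a + b) *\<^sub>R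
      hbracket (hbracket [\<alpha>s ! a, \<alpha>s ! b] # omit a (omit b \<alpha>s)))"
    unfolding bracket_contractions_def scaleR_sum_right length_map
  proof (intro sum.cong refl)
    fix b a assume "b \<in> {..<?m}" "a \<in> {..<b}"
    then have ab: "a < b" "b < ?m" by auto
    then have h: "\<alpha>s ! a \<in> \<H>" "\<alpha>s ! b \<in> \<H>" using assms by auto
    have os: "set (omit a (omit b \<alpha>s)) \<subseteq> \<H>"
      by (rule order_trans[OF set_omit2 assms])
    note p = ham_bracket_pair[OF h some_ham_vf[OF h(1)] some_ham_vf[OF h(2)]]
    have len: "Suc (length (omit a (omit b \<alpha>s))) = ?m - 1"
      using ab by (simp add: length_omit)
    have "hbracket (hbracket [\<alpha>s ! a, \<alpha>s ! b] # omit a (omit b \<alpha>s))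
      = varsigma (length (hbracket [\<alpha>s ! a, \<alpha>s ! b] # omit a (omit b \<alpha>s))) *\<^sub>R
        contraction (lie_bracket (?v (\<alpha>s ! a)) (?v (\<alpha>s ! b)) # map ?v (omit a (omit b \<alpha>s))) \<omega>"
      by (rule ham_bracket_eq) (use p os list_all2_some_ham_vf[OF os] in simp_all)
    then have "hbracket (hbracket [\<alpha>s ! a, \<alpha>s ! b] # omit a (omit b \<alpha>s))
      = varsigma (?m - 1) *\<^sub>R contraction (lie_bracket (?v (\<alpha>s ! a)) (?v (\<alpha>s ! b))
          # map ?v (omit a (omit b \<alpha>s))) \<omega>"
      unfolding list.size(4) add_Suc_right add_0_right len .
    moreover have "varsigma ?m * (-1) ^ ?m = varsigma (?m - 1)"
      using ab varsigma_Suc by (cases ?m) (simp_all del: power_Suc)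
    ultimately show "(varsigma ?m * (-1) ^ ?m) *\<^sub>R (-1) ^ (a + b) *\<^sub>R
        contraction (lie_bracket (map ?v \<alpha>s ! a) (map ?v \<alpha>s ! b) # omit a (omit b (map ?v \<alpha>s))) \<omega>
      = (-1) ^ (a + b) *\<^sub>R hbracket (hbracket [\<alpha>s ! a, \<alpha>s ! b] # omit a (omit b \<alpha>s))"
      using ab by (simp add: omit_map mult.commute)
  qed
  finally show ?thesis .
qed

lemma d_d_ham_bracket: "set \<alpha>s \<subseteq> \<H> \<Longrightarrow> d (d (hbracket \<alpha>s)) = 0"
  using d_d[OF ham_bracket_cochain] .

section \<open>The graded vector space\<close>

abbreviation "\<W> \<equiv> plectic_space M n \<omega>"

lemma subspace_plectic_space: "subspace (\<W> p)"
proof -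
  have s0: "subspace {0 :: 'b :: real_vector}"
    by (rule subspaceI) simp_all
  show ?thesis
    unfolding plectic_space_def
    by (simp add: s0 subspace_Times subspace_forms subspace_ham_forms)
qed

text \<open>
  For sums of forms whose first component is known to be zero.
\<close>

lemma subspace_plectic_forms: "subspace {\<alpha>. (0, \<alpha>) \<in> \<W> p}"
proof (rule subspaceI)
  show "0 \<in> {\<alpha>. (0, \<alpha>) \<in> \<W> p}"
    using subspace_0[OF subspace_plectic_space] by (simp add: zero_prod_def)
  show "\<alpha> + \<beta> \<in> {\<alpha>. (0, \<alpha>) \<in> \<W> p}"
    if "\<alpha> \<in> {\<alpha>. (0, \<alpha>) \<in> \<W> p}" "\<beta> \<in> {\<alpha>. (0, \<alpha>) \<in> \<W> p}" for \<alpha> \<beta>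
    using subspace_add[OF subspace_plectic_space, of "(0, \<alpha>)" p "(0, \<beta>)"] that by simp
  show "c *\<^sub>R \<alpha> \<in> {\<alpha>. (0, \<alpha>) \<in> \<W> p}" if "\<alpha> \<in> {\<alpha>. (0, \<alpha>) \<in> \<W> p}" for c \<alpha>
    using subspace_scale[OF subspace_plectic_space, of "(0, \<alpha>)" p c] that by simp
qed

text \<open>
  In degree \<open>0\<close>, that is for two arguments, membership requires a Hamiltonian form. For more than \<open>n + 1\<close>
  arguments the component is zero, as is the contraction.
\<close>

lemma ham_bracket_degree:
  assumes "set \<alpha>s \<subseteq> \<H>" "\<alpha>s \<noteq> []"
  shows "(0, hbracket \<alpha>s) \<in> \<W> (2 - int (length \<alpha>s))"
proof -
  let ?k = "length \<alpha>s"
  have form: "hbracket \<alpha>s \<in> forms M (n + 1 - ?k)" if "?k \<le> n + 1"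
    using contraction_in_forms[OF \<omega>_form some_ham_vf_in[OF assms(1)]] that
      subspace_scale[OF subspace_forms]
    by (simp add: ham_bracket_def)
  have zero: "hbracket \<alpha>s = 0" if "n + 1 < ?k"
    using contraction_eq_zero[OF \<omega>_form, of "map (some_ham_vf M \<omega>) \<alpha>s"] that
    by (simp add: ham_bracket_def)
  consider "?k = 1" | "?k = 2" | "?k \<ge> 3"
  proof -
    have "?k \<noteq> 0" using assms(2) by simp
    then show ?thesis using that by linarith
  qed
  then show ?thesis
  proof cases
    case 1
    then show ?thesis using form n_pos by (simp add: plectic_space_def)
  next
    case 2
    then obtain \<alpha> \<beta> where "\<alpha>s = [\<alpha>, \<beta>]"
      by (auto simp: length_Suc_conv numeral_2_eq_2)
    with assms ham_bracket_pair(1)[OF _ _ some_ham_vf some_ham_vf] 2 show ?thesis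
      by (simp add: plectic_space_def)
  next
    case 3
    show ?thesis
    proof (cases "?k \<le> n + 1")
      case True
      then have "nat (int n - 1 + (2 - int ?k)) = n + 1 - ?k" by simp
      then show ?thesis using form[OF True] True 3 assms(2) by (simp add: plectic_space_def)
    next
      case False
      then show ?thesis
        using zero subspace_0[OF subspace_plectic_forms] by simp
    qed
  qed
qed

text \<open>
  Linearity over functions and, for three arguments, a Hamiltonian vector field are inherited from
  the nested brackets in the expansion of the differential.
\<close>

lemma d_ham_bracket_degree:
  assumes "set \<alpha>s \<subseteq> \<H>"
  shows "(0, d (hbracket \<alpha>s)) \<in> \<W> (3 - int (length \<alpha>s))"
proof -
  have "hbracket (hbracket [\<alpha>s ! a, \<alpha>s ! b] # omit a (omit b \<alpha>s)) \<in> {\<alpha>. (0, \<alpha>) \<in> \<W> (3 - int (length \<alpha>s))}"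
    if "a < b" "b < length \<alpha>s" for a b
  proof -
    have h: "\<alpha>s ! a \<in> \<H>" "\<alpha>s ! b \<in> \<H>" using assms that by auto
    have "set (hbracket [\<alpha>s ! a, \<alpha>s ! b] # omit a (omit b \<alpha>s)) \<subseteq> \<H>"
      using order_trans[OF set_omit2 assms] ham_bracket_pair(1)[OF h some_ham_vf[OF h(1)] some_ham_vf[OF h(2)]]
      by simp
    from ham_bracket_degree[OF this] that show ?thesis
      by (simp add: length_omit)
  qed
  then have "d (hbracket \<alpha>s) \<in> {\<alpha>. (0, \<alpha>) \<in> \<W> (3 - int (length \<alpha>s))}"
    unfolding d_ham_bracket[OF assms]
    by (intro subspace_sum[OF subspace_plectic_forms] subspace_scale[OF subspace_plectic_forms]) auto
  then show ?thesis by simp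
qed

end

section \<open>Permutations of lists and antisymmetry\<close>

lemma length_permute_entries [simp]: "length (permute_entries \<sigma> ws) = length ws"
  by (simp add: permute_entries_def)

lemma nth_permute_entries [simp]: "a < length ws \<Longrightarrow> permute_entries \<sigma> ws ! a = ws ! \<sigma> a"
  by (simp add: permute_entries_def)

lemma permute_entries_id [simp]: "permute_entries id ws = ws"
  by (rule nth_equalityI) simp_all

lemma permute_entries_comp:
  assumes "\<tau> permutes {..<length ws}"
  shows "permute_entries (\<sigma> \<circ> \<tau>) ws = permute_entries \<tau> (permute_entries \<sigma> ws)"
proof (rule nth_equalityI)
  fix a assume "a < length (permute_entries (\<sigma> \<circ> \<tau>) ws)"
  then have "a < length ws" "\<tau> a < length ws"
    using permutes_in_image[OF assms, of a] by auto
  then show "permute_entries (\<sigma> \<circ> \<tau>) ws ! a = permute_entries \<tau> (permute_entries \<sigma> ws) ! a"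
    by simp
qed simp

lemma mset_permute_entries:
  assumes "\<sigma> permutes {..<length ws}"
  shows "mset (permute_entries \<sigma> ws) = mset ws"
proof -
  have "permute_entries \<sigma> ws = permute_list \<sigma> ws"
    by (simp add: permute_entries_def permute_list_def)
  then show ?thesis using mset_permute_list[OF assms] by simp
qed

lemma set_permute_entries:
  "\<sigma> permutes {..<length ws} \<Longrightarrow> set (permute_entries \<sigma> ws) = set ws"
  by (metis mset_permute_entries set_mset_mset)

lemma permute_entries_adjacent:
  assumes "Suc i < length ws"
  shows "permute_entries (Transposition.transpose i (Suc i)) ws = take i ws @ ws ! Suc i # ws ! i # drop (Suc (Suc i)) ws"
proof (rule nth_equalityI)
  fix a assume "a < length (permute_entries (Transposition.transpose i (Suc i)) ws)"
  then have a: "a < length ws" by simp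
  consider "a < i" | "a = i" | "a = Suc i" | "a > Suc i" by linarith
  then show "permute_entries (Transposition.transpose i (Suc i)) ws ! a
      = (take i ws @ ws ! Suc i # ws ! i # drop (Suc (Suc i)) ws) ! a"
  proof cases
    case 4
    then obtain k where "a = Suc (Suc (i + k))"
      using less_iff_Suc_add[of "Suc i" a] by auto
    then show ?thesis using a assms by (simp add: nth_append Transposition.transpose_def)
  qed (use a assms in \<open>simp_all add: nth_append Transposition.transpose_def\<close>)
qed (use assms in simp)

lemma split_adjacent:
  "Suc i < length ws \<Longrightarrow> ws = take i ws @ ws ! i # ws ! Suc i # drop (Suc (Suc i)) ws"
  by (simp add: Cons_nth_drop_Suc)

text \<open>
  For a fixed permutation and all lists of one length, since the induction over transpositions
  permutes the list as well.
\<close>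

definition sign_equivariant :: "'b set \<Rightarrow> nat \<Rightarrow> ('b list \<Rightarrow> 'v::real_vector) \<Rightarrow> (nat \<Rightarrow> nat) \<Rightarrow> bool" where
  "sign_equivariant D m f \<sigma> \<longleftrightarrow>
     (\<forall>ws. length ws = m \<and> set ws \<subseteq> D \<longrightarrow> f (permute_entries \<sigma> ws) = of_int (sign \<sigma>) *\<^sub>R f ws)"

lemma sign_equivariant_comp:
  assumes "\<sigma> permutes {..<m}" "\<tau> permutes {..<m}"
    and "sign_equivariant D m f \<sigma>" "sign_equivariant D m f \<tau>"
  shows "sign_equivariant D m f (\<sigma> \<circ> \<tau>)"
  unfolding sign_equivariant_def
proof (intro allI impI)
  fix ws assume ws: "length ws = m \<and> set ws \<subseteq> D"
  have "f (permute_entries (\<sigma> \<circ> \<tau>) ws) = f (permute_entries \<tau> (permute_entries \<sigma> ws))"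
    using ws assms(2) by (simp add: permute_entries_comp)
  also have "\<dots> = of_int (sign \<tau>) *\<^sub>R of_int (sign \<sigma>) *\<^sub>R f ws"
    using ws assms set_permute_entries[of \<sigma> ws] by (simp add: sign_equivariant_def)
  also have "\<dots> = of_int (sign (\<sigma> \<circ> \<tau>)) *\<^sub>R f ws"
    using sign_compose[OF permutation_permutes[THEN iffD2] permutation_permutes[THEN iffD2], of \<sigma> \<tau>] assms
    by (simp add: mult.commute) (metis finite_lessThan mult.commute of_int_mult)
  finally show "f (permute_entries (\<sigma> \<circ> \<tau>) ws) = of_int (sign (\<sigma> \<circ> \<tau>)) *\<^sub>R f ws" .
qed

text \<open>
  Adjacent transpositions generate: \<open>(i j+1) = (j j+1) (i j) (j j+1)\<close> reaches every transposition.
\<close>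

lemma sign_equivariant_of_adjacent:
  assumes adj: "\<And>us x y vs. set (us @ x # y # vs) \<subseteq> D \<Longrightarrow> f (us @ y # x # vs) = - f (us @ x # y # vs)"
    and "\<sigma> permutes {..<m}"
  shows "sign_equivariant D m f \<sigma>"
proof -
  have adjacent: "sign_equivariant D m f (Transposition.transpose i (Suc i))" if "Suc i < m" for i
    unfolding sign_equivariant_def
  proof (intro allI impI)
    fix ws assume ws: "length ws = m \<and> set ws \<subseteq> D"
    let ?us = "take i ws" and ?vs = "drop (Suc (Suc i)) ws"
    have s: "ws = ?us @ ws ! i # ws ! Suc i # ?vs"
      using that ws by (intro split_adjacent) simp
    have "f (permute_entries (Transposition.transpose i (Suc i)) ws) = f (?us @ ws ! Suc i # ws ! i # ?vs)"
      using that ws by (simp add: permute_entries_adjacent)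
    also have "\<dots> = - f (?us @ ws ! i # ws ! Suc i # ?vs)"
      by (rule adj) (use ws s in metis)
    finally show "f (permute_entries (Transposition.transpose i (Suc i)) ws) = of_int (sign (Transposition.transpose i (Suc i))) *\<^sub>R f ws"
      using s by (simp add: sign_swap_id)
  qed
  have swap: "sign_equivariant D m f (Transposition.transpose i j)" if "i < j" "j < m" for i j
    using that
  proof (induction j)
    case (Suc j)
    show ?case
    proof (cases "i = j")
      case True
      then show ?thesis using adjacent Suc.prems by simp
    next
      case False
      then have ij: "i < j" using Suc.prems by simp
      have eq: "Transposition.transpose i (Suc j) = Transposition.transpose j (Suc j) \<circ> (Transposition.transpose i j \<circ> Transposition.transpose j (Suc j))"
        using ij by (auto simp: fun_eq_iff Transposition.transpose_def)
      have p: "Transposition.transpose j (Suc j) permutes {..<m}" "Transposition.transpose i j permutes {..<m}"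
        using ij Suc.prems by (auto intro!: permutes_swap_id)
      show ?thesis
        unfolding eq using Suc ij p
        by (intro sign_equivariant_comp permutes_compose adjacent) auto
    qed
  qed simp
  show ?thesis
    using finite_lessThan assms(2)
  proof (induction rule: permutes_rev_induct)
    case id
    show ?case unfolding sign_equivariant_def permute_entries_id sign_id by simp
  next
    case (swap a b p)
    have "sign_equivariant D m f (Transposition.transpose a b)"
      using swap(1-3) \<open>\<And>j i. i < j \<Longrightarrow> j < m \<Longrightarrow> sign_equivariant D m f (Transposition.transpose i j)\<close>[of a b]
        \<open>\<And>j i. i < j \<Longrightarrow> j < m \<Longrightarrow> sign_equivariant D m f (Transposition.transpose i j)\<close>[of b a]
      by (cases "a < b") (auto simp: transpose_commute)
    then show ?case
      using swap by (intro sign_equivariant_comp) (auto intro!: permutes_swap_id)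
  qed
qed

section \<open>Unshuffles with at most two entries in the first block\<close>

text \<open>
  The cycle \<open>(0 j j-1 \<dots> 1)\<close>, which moves the entry at position \<open>j\<close> to the front of a list and keeps the
  order of the others; its construction from \<open>j\<close> adjacent transpositions exhibits its sign.
\<close>

primrec move_front :: "nat \<Rightarrow> nat \<Rightarrow> nat" where
  "move_front 0 = id"
| "move_front (Suc j) = Transposition.transpose j (Suc j) \<circ> move_front j"

lemma move_front_permutes: "j < m \<Longrightarrow> move_front j permutes {..<m}"
  by (induction j) (auto intro!: permutes_compose permutes_swap_id permutes_id)

lemma sign_move_front: "sign (move_front j) = (-1) ^ j"
proof (induction j)
  case (Suc j)
  have "permutation (move_front j)"
    using move_front_permutes[of j "Suc j"] finite_lessThan permutation_permutes by blast
  then have "sign (move_front (Suc j)) = sign (Transposition.transpose j (Suc j)) * sign (move_front j)"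
    by (simp only: move_front.simps sign_compose permutation_swap_id)
  then show ?case unfolding Suc by (simp add: sign_swap_id del: move_front.simps)
qed simp

lemma permute_entries_move_front:
  "j < length ws \<Longrightarrow> permute_entries (move_front j) ws = ws ! j # omit j ws"
proof (induction j arbitrary: ws)
  case 0
  then obtain w vs where "ws = w # vs" by (cases ws) auto
  then show ?case by (simp only: move_front.simps(1) permute_entries_id nth_Cons_0 omit_Cons)
next
  case (Suc j)
  let ?ws = "take j ws @ ws ! Suc j # ws ! j # drop (Suc (Suc j)) ws"
  have "permute_entries (move_front (Suc j)) ws = permute_entries (move_front j) ?ws"
    using Suc.prems
    by (simp only: move_front.simps permute_entries_comp[OF move_front_permutes[OF Suc_lessD]]
        permute_entries_adjacent)
  also have "\<dots> = ?ws ! j # omit j ?ws"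
    using Suc.prems by (intro Suc.IH) simp
  also have "\<dots> = ws ! Suc j # omit (Suc j) ws"
    using Suc.prems by (simp add: nth_append omit_append) (simp add: omit_def take_Suc_conv_app_nth)
  finally show ?case .
qed

text \<open>
  The unshuffle that moves the entries at \<open>a < b\<close> to the front: first the one at \<open>b\<close>, after which the
  other one sits at position \<open>a + 1\<close>.
\<close>

definition pair_unshuffle :: "nat \<Rightarrow> nat \<Rightarrow> nat \<Rightarrow> nat" where
  "pair_unshuffle a b = move_front b \<circ> move_front (Suc a)"

lemma pair_unshuffle_permutes: "a < b \<Longrightarrow> b < m \<Longrightarrow> pair_unshuffle a b permutes {..<m}"
  unfolding pair_unshuffle_def by (intro permutes_compose move_front_permutes) simp_all

lemma sign_pair_unshuffle: "sign (pair_unshuffle a b) = (-1) ^ (a + b + 1)"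
proof -
  have "permutation (move_front j)" for j
    using move_front_permutes[of j "Suc j"] finite_lessThan permutation_permutes by blast
  then show ?thesis
    unfolding pair_unshuffle_def by (simp add: sign_compose sign_move_front power_add del: move_front.simps)
qed

lemma permute_entries_pair_unshuffle:
  assumes "a < b" "b < length ws"
  shows "permute_entries (pair_unshuffle a b) ws = ws ! a # ws ! b # omit a (omit b ws)"
proof -
  have "permute_entries (pair_unshuffle a b) ws = permute_entries (move_front (Suc a)) (ws ! b # omit b ws)"
    using assms
    by (simp add: pair_unshuffle_def permute_entries_comp move_front_permutes permute_entries_move_front del: move_front.simps)
  also have "\<dots> = omit b ws ! a # ws ! b # omit a (omit b ws)"
    using assms by (subst permute_entries_move_front) (simp_all add: length_omit)
  also have "omit b ws ! a = ws ! a"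
    using assms by (simp add: omit_def nth_append)
  finally show ?thesis .
qed

lemma sorted_wrt_omit: "sorted_wrt P xs \<Longrightarrow> sorted_wrt P (omit i xs)"
proof -
  assume "sorted_wrt P xs"
  then have "sorted_wrt P (take i xs @ drop i xs)" by simp
  then show ?thesis
    unfolding omit_def sorted_wrt_append
    using set_drop_subset_set_drop[of i "Suc i" xs] by (auto simp: sorted_wrt_drop \<open>sorted_wrt P xs\<close>)
qed

lemma strict_mono_on_iff_sorted_map:
  "strict_mono_on {i..<m} (\<sigma> :: nat \<Rightarrow> nat) \<longleftrightarrow> sorted_wrt (<) (map \<sigma> [i..<m])"
proof -
  have "sorted_wrt (<) (map \<sigma> [i..<m]) \<longleftrightarrow> (\<forall>a b. a < b \<and> b < m - i \<longrightarrow> \<sigma> (i + a) < \<sigma> (i + b))"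
    by (auto simp: sorted_wrt_iff_nth_less)
  also have "\<dots> \<longleftrightarrow> strict_mono_on {i..<m} \<sigma>"
  proof
    assume *: "\<forall>a b. a < b \<and> b < m - i \<longrightarrow> \<sigma> (i + a) < \<sigma> (i + b)"
    show "strict_mono_on {i..<m} \<sigma>"
    proof (rule strict_mono_onI)
      fix r s assume "r \<in> {i..<m}" "s \<in> {i..<m}" "r < s"
      then have "r - i < s - i \<and> s - i < m - i" "i + (r - i) = r" "i + (s - i) = s" by auto
      with *[rule_format, of "r - i" "s - i"] show "\<sigma> r < \<sigma> s" by simp
    qed
  next
    assume "strict_mono_on {i..<m} \<sigma>"
    then show "\<forall>a b. a < b \<and> b < m - i \<longrightarrow> \<sigma> (i + a) < \<sigma> (i + b)"
      by (auto intro!: strict_mono_onD[of "{i..<m}" \<sigma>])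
  qed
  finally show ?thesis by simp
qed

lemma permutes_eqI:
  assumes "\<sigma> permutes {..<m}" "\<tau> permutes {..<m}" "map \<sigma> [0..<m] = map \<tau> [0..<m]"
  shows "\<sigma> = \<tau>"
proof
  fix a show "\<sigma> a = \<tau> a"
    using assms permutes_not_in[OF assms(1), of a] permutes_not_in[OF assms(2), of a]
    by (cases "a < m") auto
qed

lemma map_pair_unshuffle:
  assumes "a < b" "b < m"
  shows "map (pair_unshuffle a b) [0..<m] = a # b # omit a (omit b [0..<m])"
proof -
  have "permute_entries (pair_unshuffle a b) [0..<m] = map (pair_unshuffle a b) [0..<m]"
  proof (rule nth_equalityI)
    fix i assume "i < length (permute_entries (pair_unshuffle a b) [0..<m])"
    then have "i < m" "pair_unshuffle a b i < m"
      using permutes_in_image[OF pair_unshuffle_permutes[OF assms], of i] by auto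
    then show "permute_entries (pair_unshuffle a b) [0..<m] ! i = map (pair_unshuffle a b) [0..<m] ! i"
      by simp
  qed simp
  then show ?thesis
    using permute_entries_pair_unshuffle[of a b "[0..<m]"] assms by simp
qed

lemma upt_conv_two: "2 \<le> m \<Longrightarrow> [0..<m] = 0 # 1 # [2..<m]"
  by (simp add: upt_conv_Cons numeral_2_eq_2)

text \<open>
  An unshuffle is determined by its first block, because its second block is the increasing
  enumeration of the complement.
\<close>

lemma unshuffles_two:
  assumes "2 \<le> m"
  shows "unshuffles 2 m = (\<lambda>(b, a). pair_unshuffle a b) ` (SIGMA b:{..<m}. {..<b})"
proof (intro equalityI subsetI)
  fix \<sigma> assume "\<sigma> \<in> unshuffles 2 m"
  then have p: "\<sigma> permutes {..<m}" and s: "strict_mono_on {..<2} \<sigma>" "strict_mono_on {2..<m} \<sigma>"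
    by (auto simp: unshuffles_def)
  define a where "a = \<sigma> 0"
  define b where "b = \<sigma> 1"
  have ab: "a < b" "b < m"
    using strict_mono_onD[OF s(1), of 0 1] permutes_in_image[OF p, of 1] assms
    by (auto simp: a_def b_def)
  have \<sigma>: "map \<sigma> [0..<m] = a # b # map \<sigma> [2..<m]"
    by (subst upt_conv_two[OF assms]) (simp add: a_def b_def)
  have d: "distinct (map \<sigma> [0..<m])" "distinct (map (pair_unshuffle a b) [0..<m])"
    "set (map \<sigma> [0..<m]) = set (map (pair_unshuffle a b) [0..<m])"
    using p pair_unshuffle_permutes[OF ab]
    by (auto simp: distinct_map permutes_inj_on atLeast0LessThan permutes_image)
  have "map \<sigma> [2..<m] = omit a (omit b [0..<m])"
  proof (rule strict_sorted_equal)
    show "sorted_wrt (<) (map \<sigma> [2..<m])"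
      using s(2) by (simp add: strict_mono_on_iff_sorted_map)
    show "sorted_wrt (<) (omit a (omit b [0..<m]))"
      by (intro sorted_wrt_omit sorted_wrt_upt)
    have *: "set xs = set (a # b # xs) - {a, b}" if "distinct (a # b # xs)" for xs
      using that by auto
    show "set (map \<sigma> [2..<m]) = set (omit a (omit b [0..<m]))"
      unfolding *[OF d(1)[unfolded \<sigma>]] *[OF d(2)[unfolded map_pair_unshuffle[OF ab]]]
      by (rule arg_cong[where f = "\<lambda>S. S - {a, b}"], rule d(3)[unfolded \<sigma> map_pair_unshuffle[OF ab]])
  qed
  then have "map \<sigma> [0..<m] = map (pair_unshuffle a b) [0..<m]"
    by (simp only: \<sigma> map_pair_unshuffle[OF ab])
  then have eq: "\<sigma> = pair_unshuffle a b"
    by (rule permutes_eqI[OF p pair_unshuffle_permutes[OF ab]])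
  have "(b, a) \<in> (SIGMA b:{..<m}. {..<b})"
    using ab by simp
  then show "\<sigma> \<in> (\<lambda>(b, a). pair_unshuffle a b) ` (SIGMA b:{..<m}. {..<b})"
    unfolding eq by (rule image_eqI[rotated]) (simp only: prod.case)
next
  fix \<sigma> assume "\<sigma> \<in> (\<lambda>(b, a). pair_unshuffle a b) ` (SIGMA b:{..<m}. {..<b})"
  then obtain a b where \<sigma>: "\<sigma> = pair_unshuffle a b" and ab: "a < b" "b < m" by auto
  have m: "0 # 1 # [2..<m] = [0..<m]" using upt_conv_two[OF assms] by simp
  have "\<sigma> 0 # \<sigma> 1 # map \<sigma> [2..<m] = a # b # omit a (omit b [0..<m])"
    using map_pair_unshuffle[OF ab] unfolding \<sigma> m[symmetric] by simp
  then have v: "\<sigma> 0 = a" "\<sigma> 1 = b" "map \<sigma> [2..<m] = omit a (omit b [0..<m])" by auto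
  have "strict_mono_on {2..<m} \<sigma>"
    unfolding strict_mono_on_iff_sorted_map v by (intro sorted_wrt_omit sorted_wrt_upt)
  moreover have "strict_mono_on {..<2} \<sigma>"
    using v(1,2) ab by (intro strict_mono_onI) (auto simp: numeral_2_eq_2 less_Suc_eq)
  ultimately show "\<sigma> \<in> unshuffles 2 m"
    using pair_unshuffle_permutes[OF ab] by (simp add: unshuffles_def \<sigma>)
qed

lemma inj_pair_unshuffle: "inj_on (\<lambda>(b, a). pair_unshuffle a b) (SIGMA b:{..<m}. {..<b})"
proof (rule inj_onI, clarsimp)
  fix a b a' b' assume h: "a < b" "b < m" "a' < b'" "b' < m" "pair_unshuffle a b = pair_unshuffle a' b'"
  have "a # b # omit a (omit b [0..<m]) = a' # b' # omit a' (omit b' [0..<m])"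
    by (simp only: map_pair_unshuffle[OF h(1,2), symmetric] map_pair_unshuffle[OF h(3,4), symmetric] h(5))
  then show "b = b' \<and> a = a'" by simp
qed

lemma sum_unshuffles_two:
  assumes "2 \<le> m"
  shows "(\<Sum>\<sigma>\<in>unshuffles 2 m. g \<sigma>) = (\<Sum>b<m. \<Sum>a<b. g (pair_unshuffle a b))"
  unfolding unshuffles_two[OF assms] sum.reindex[OF inj_pair_unshuffle]
  by (subst sum.Sigma) (auto intro!: sum.cong)

lemma unshuffles_zero: "unshuffles 0 m = {id}"
proof (intro equalityI subsetI)
  fix \<sigma> assume "\<sigma> \<in> unshuffles 0 m"
  then have p: "\<sigma> permutes {..<m}" and s: "strict_mono_on {0..<m} \<sigma>"
    by (auto simp: unshuffles_def)
  have "map \<sigma> [0..<m] = [0..<m]"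
  proof (rule strict_sorted_equal[OF sorted_wrt_upt])
    show "sorted_wrt (<) (map \<sigma> [0..<m])"
      using s by (rule strict_mono_on_iff_sorted_map[THEN iffD1])
    show "set (map \<sigma> [0..<m]) = set [0..<m]"
      using permutes_image[OF p] by (simp add: atLeast0LessThan)
  qed
  then have "map \<sigma> [0..<m] = map id [0..<m]"
    by (simp only: list.map_id)
  from permutes_eqI[OF p permutes_id this] show "\<sigma> \<in> {id}"
    by (simp only: singleton_iff)
qed (auto simp: unshuffles_def permutes_id strict_mono_on_def)

section \<open>Lists with few entries of nonzero degree\<close>

text \<open>
  The multibrackets vanish on lists with more than one entry of nonzero degree or with one whose
  degree is not \<open>2\<close>, so all arguments below are case distinctions on these entries.
\<close>

definition nonzero_entries :: "(int \<times> 'v) list \<Rightarrow> (int \<times> 'v) list" where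
  "nonzero_entries ws = filter (\<lambda>w. fst w \<noteq> 0) ws"

definition zero_entries :: "(int \<times> 'v) list \<Rightarrow> (int \<times> 'v) list" where
  "zero_entries ws = filter (\<lambda>w. fst w = 0) ws"

lemma nonzero_entries_simps [simp]:
  "nonzero_entries [] = []"
  "nonzero_entries (w # ws) = (if fst w = 0 then nonzero_entries ws else w # nonzero_entries ws)"
  "nonzero_entries (us @ vs) = nonzero_entries us @ nonzero_entries vs"
  by (simp_all add: nonzero_entries_def)

lemma zero_entries_simps [simp]:
  "zero_entries [] = []"
  "zero_entries (w # ws) = (if fst w = 0 then w # zero_entries ws else zero_entries ws)"
  "zero_entries (us @ vs) = zero_entries us @ zero_entries vs"
  by (simp_all add: zero_entries_def)

lemma nonzero_entries_eq_Nil: "nonzero_entries ws = [] \<longleftrightarrow> (\<forall>w\<in>set ws. fst w = 0)"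
  by (induction ws) auto

lemma zero_entries_id: "nonzero_entries ws = [] \<Longrightarrow> zero_entries ws = ws"
  by (induction ws) (auto split: if_splits)

lemma nonzero_entries_singleE:
  assumes "nonzero_entries ws = [w]"
  obtains us vs where "ws = us @ w # vs" "nonzero_entries us = []" "nonzero_entries vs = []" "fst w \<noteq> 0"
  using filter_eq_ConsD[OF assms[unfolded nonzero_entries_def]]
  by (auto simp: nonzero_entries_def filter_empty_conv[symmetric])

lemma length_entries: "length ws = length (zero_entries ws) + length (nonzero_entries ws)"
  by (induction ws) auto

lemma total_degree_simps [simp]:
  "total_degree [] = 0" "total_degree (w # ws) = fst w + total_degree ws"
  by (simp_all add: total_degree_def)

lemma total_degree_nonzero_entries: "total_degree ws = total_degree (nonzero_entries ws)"
  by (induction ws) auto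

text \<open>
  With at most one entry of nonzero degree every inversion contributes a factor with exponent \<open>0\<close>.
\<close>

lemma koszul_sign_eq_1:
  assumes "length (nonzero_entries ws) \<le> 1" "\<sigma> permutes {..<length ws}"
  shows "koszul_sign \<sigma> ws = 1"
proof -
  have aux: "fst (ws ! i) = 0 \<or> fst (ws ! j) = 0" if "i < j" "j < length ws" for i j
  proof (rule ccontr)
    assume n: "\<not> (fst (ws ! i) = 0 \<or> fst (ws ! j) = 0)"
    have "ws = take j ws @ ws ! j # drop (Suc j) ws"
      using that by (simp add: id_take_nth_drop)
    then have "length (nonzero_entries ws)
        = length (nonzero_entries (take j ws)) + Suc (length (nonzero_entries (drop (Suc j) ws)))"
      using n by (metis length_append length_Cons nonzero_entries_simps(2,3))
    moreover have "ws ! i \<in> set (take j ws)"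
      using that by (auto simp: in_set_conv_nth intro!: exI[of _ i])
    then have "nonzero_entries (take j ws) \<noteq> []"
      using n by (auto simp: nonzero_entries_eq_Nil)
    ultimately show False using assms(1) by (cases "nonzero_entries (take j ws)") auto
  qed
  have "(if \<sigma> b < \<sigma> a then (- 1) powi (fst (ws ! \<sigma> a) * fst (ws ! \<sigma> b)) else (1::real)) = 1"
    if "a < b" "b < length ws" for a b
  proof -
    have "\<sigma> a < length ws" "\<sigma> b < length ws"
      using that permutes_in_image[OF assms(2)] by (metis lessThan_iff less_trans)+
    then show ?thesis using aux[of "\<sigma> b" "\<sigma> a"] by auto
  qed
  then show ?thesis
    unfolding koszul_sign_def by (intro prod.neutral ballI) auto
qed

definition leading_zeros :: "(int \<times> 'v) list \<Rightarrow> nat" where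
  "leading_zeros ws = length (takeWhile (\<lambda>w. fst w = 0) ws)"

lemma leading_zeros_simps [simp]:
  "leading_zeros [] = 0"
  "leading_zeros (w # ws) = (if fst w = 0 then Suc (leading_zeros ws) else 0)"
  by (simp_all add: leading_zeros_def)

lemma leading_zeros_append [simp]:
  "leading_zeros (us @ vs) =
     (if nonzero_entries us = [] then length us + leading_zeros vs else leading_zeros us)"
  by (induction us) auto

lemma first_nonzero_entryE:
  assumes "nonzero_entries ws \<noteq> []"
  obtains us w vs where "ws = us @ w # vs" "nonzero_entries us = []" "fst w \<noteq> 0"
  using assms
proof (induction ws arbitrary: thesis)
  case (Cons u ws)
  show ?case
  proof (cases "fst u = 0")
    case True
    with Cons.prems(2) have "nonzero_entries ws \<noteq> []" by simp
    from Cons.IH[OF _ this] obtain us w vs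
      where "ws = us @ w # vs" "nonzero_entries us = []" "fst w \<noteq> 0" by blast
    then show ?thesis using Cons.prems(1)[of "u # us" w vs] True by simp
  next
    case False
    then show ?thesis using Cons.prems(1)[of "[]" u ws] by simp
  qed
qed simp

lemma mset_nonzero_entries: "mset us = mset ws \<Longrightarrow> mset (nonzero_entries us) = mset (nonzero_entries ws)"
  by (simp add: nonzero_entries_def mset_filter)

lemma mset_eq_singleton_list:
  assumes "mset xs = mset ys" "length xs = 1"
  shows "xs = ys"
proof -
  obtain x where "xs = [x]" using assms(2) by (auto simp: length_Suc_conv)
  with assms(1) show ?thesis by simp
qed

section \<open>Sums over pairs that avoid one position\<close>

text \<open>
  The increasing enumeration of the natural numbers other than \<open>q\<close>.
\<close>

definition skip :: "nat \<Rightarrow> nat \<Rightarrow> nat" where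
  "skip q j = (if j < q then j else Suc j)"

lemma sum_skip:
  assumes "q \<le> N" "f q = (0 :: 'v :: comm_monoid_add)"
  shows "(\<Sum>b<Suc N. f b) = (\<Sum>b<N. f (skip q b))"
  using assms(1)
proof (induction N rule: dec_induct)
  case base
  then show ?case by (simp add: skip_def assms(2))
next
  case (step N)
  then show ?case by (simp add: skip_def)
qed

lemma sum_pairs_skip:
  assumes "q \<le> N" and "\<And>a b. a < b \<Longrightarrow> b < Suc N \<Longrightarrow> a = q \<or> b = q \<Longrightarrow> P a b = (0 :: 'v :: comm_monoid_add)"
  shows "(\<Sum>b<Suc N. \<Sum>a<b. P a b) = (\<Sum>b<N. \<Sum>a<b. P (skip q a) (skip q b))"
proof -
  have "(\<Sum>b<Suc N. \<Sum>a<b. P a b) = (\<Sum>b<N. \<Sum>a<skip q b. P a (skip q b))"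
    by (rule sum_skip[OF assms(1)]) (use assms in \<open>auto intro!: sum.neutral\<close>)
  also have "\<dots> = (\<Sum>b<N. \<Sum>a<b. P (skip q a) (skip q b))"
  proof (rule sum.cong[OF refl])
    fix b assume b: "b \<in> {..<N}"
    show "(\<Sum>a<skip q b. P a (skip q b)) = (\<Sum>a<b. P (skip q a) (skip q b))"
    proof (cases "b < q")
      case True
      then show ?thesis by (simp add: skip_def)
    next
      case False
      have "(\<Sum>a<Suc b. P a (Suc b)) = (\<Sum>a<b. P (skip q a) (Suc b))"
        by (rule sum_skip) (use False b assms(2)[of q "Suc b"] in auto)
      then show ?thesis using False by (simp add: skip_def[of q b])
    qed
  qed
  finally show ?thesis .
qed

lemma sum_pairs_neutral:
  assumes "\<not> 2 \<le> (m :: nat)"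
  shows "(\<Sum>b<m. \<Sum>a<b. P a b) = (0 :: 'v :: comm_monoid_add)"
proof -
  from assms have "m = 0 \<or> m = 1" by linarith
  then show ?thesis by auto
qed

lemma nth_skip:
  "j < length (us @ vs) \<Longrightarrow> (us @ w # vs) ! skip (length us) j = (us @ vs) ! j"
  by (auto simp: skip_def nth_append Suc_diff_le)

text \<open>
  Positions of a list with a marked entry \<open>w\<close> against positions of the same list without it. Each of the
  removed entries stands either before \<open>w\<close>, lowering the position of \<open>w\<close> by one, or behind it, where
  its own position is raised by one; the parity of the sum is the same in both cases.
\<close>

lemma omit_two_skipE:
  assumes "a < b" "b < length (us @ vs)"
  obtains us' vs' where
    "omit (skip (length us) a) (omit (skip (length us) b) (us @ w # vs)) = us' @ w # vs'"
    "us' @ vs' = omit a (omit b (us @ vs))"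
    "(-1 :: real) ^ (skip (length us) a + skip (length us) b + length us') = (-1) ^ (a + b + length us)"
proof -
  let ?q = "length us"
  consider "b < ?q" | "a < ?q" "?q \<le> b" | "?q \<le> a" by linarith
  then show ?thesis
  proof cases
    case 1
    then have a: "a < length (omit b us)" and l: "length us = Suc (length (omit b us))"
      using assms by (simp_all add: length_omit)
    have "omit (skip ?q a) (omit (skip ?q b) (us @ w # vs)) = omit a (omit b us) @ w # vs"
      using 1 a assms by (simp add: skip_def omit_append)
    moreover have "omit a (omit b us) @ vs = omit a (omit b (us @ vs))"
      using 1 a assms by (simp add: omit_append)
    moreover have "length us = Suc (Suc (length (omit a (omit b us))))"
      using a l by (simp add: length_omit)
    then have "(-1 :: real) ^ (skip ?q a + skip ?q b + length (omit a (omit b us))) = (-1) ^ (a + b + ?q)"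
      using 1 assms by (simp add: skip_def)
    ultimately show ?thesis by (rule that)
  next
    case 2
    have "omit (skip ?q a) (omit (skip ?q b) (us @ w # vs)) = omit a us @ w # omit (b - ?q) vs"
      using 2 assms by (simp add: skip_def omit_append Suc_diff_le)
    moreover have "omit a us @ omit (b - ?q) vs = omit a (omit b (us @ vs))"
      using 2 assms by (simp add: omit_append)
    moreover have "length us = Suc (length (omit a us))"
      using 2 assms by (simp add: length_omit)
    then have "(-1 :: real) ^ (skip ?q a + skip ?q b + length (omit a us)) = (-1) ^ (a + b + ?q)"
      using 2 assms by (simp add: skip_def)
    ultimately show ?thesis by (rule that)
  next
    case 3
    have "omit (skip ?q a) (omit (skip ?q b) (us @ w # vs)) = us @ w # omit (a - ?q) (omit (b - ?q) vs)"
      using 3 assms by (simp add: skip_def omit_append Suc_diff_le)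
    moreover have "us @ omit (a - ?q) (omit (b - ?q) vs) = omit a (omit b (us @ vs))"
      using 3 assms by (simp add: omit_append)
    moreover have "(-1 :: real) ^ (skip ?q a + skip ?q b + length us) = (-1) ^ (a + b + ?q)"
      using 3 assms by (simp add: skip_def)
    ultimately show ?thesis by (rule that)
  qed
qed

lemma sum_Pair_zero: "(\<Sum>i\<in>I. (0 :: 'v :: real_vector, f i)) = (0, \<Sum>i\<in>I. f i)"
  by (simp add: prod_eq_iff fst_sum snd_sum)

section \<open>Multilinearity and antisymmetry of the multibrackets\<close>

context pre_plectic_mfd begin

abbreviation form :: "int \<times> real \<times> 'a dform \<Rightarrow> 'a dform" where
  "form w \<equiv> snd (snd w)"

abbreviation "bracket \<equiv> plectic_bracket M \<omega>"

lemma bracket_Nil: "bracket [] = (varsigma 0, 0)"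
  by (simp add: plectic_bracket_def)

lemma bracket_zero: "nonzero_entries ws = [] \<Longrightarrow> ws \<noteq> [] \<Longrightarrow> bracket ws = (0, hbracket (map form ws))"
proof -
  assume ws: "nonzero_entries ws = []" "ws \<noteq> []"
  then have "dropWhile (\<lambda>w. fst w = 0) ws = []"
    by (simp add: nonzero_entries_eq_Nil dropWhile_eq_Nil_conv)
  then show ?thesis
    by (simp only: plectic_bracket_def Let_def list.case ws(2) if_False)
qed

lemma bracket_split:
  assumes us: "nonzero_entries us = []" and p: "fst w \<noteq> 0"
  shows "bracket (us @ w # vs) =
    (if fst w = 2 \<and> nonzero_entries vs = [] \<and> 2 \<le> length (us @ vs)
     then (0, (- fst (snd w) * (-1) ^ length us) *\<^sub>R d (hbracket (map form (us @ vs)))) else 0)"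
proof -
  have "takeWhile (\<lambda>w. fst w = 0) (us @ w # vs) = us" "dropWhile (\<lambda>w. fst w = 0) (us @ w # vs) = w # vs"
    using us p by (auto simp: nonzero_entries_eq_Nil takeWhile_append dropWhile_append)
  then show ?thesis
    by (cases w) (simp add: plectic_bracket_def nonzero_entries_eq_Nil)
qed

text \<open>
  A description of the multibrackets by filters, which is easier to evaluate on permuted and
  concatenated lists than the split at the first entry of nonzero degree.
\<close>

lemma bracket_formula:
  "bracket ws =
    (if nonzero_entries ws = []
     then (if ws = [] then (varsigma 0, 0) else (0, hbracket (map form ws)))
     else if fst (hd (nonzero_entries ws)) = 2 \<and> length (nonzero_entries ws) = 1
             \<and> 2 \<le> length (zero_entries ws)
     then (0, (- fst (snd (hd (nonzero_entries ws))) * (-1) ^ leading_zeros ws) *\<^sub>R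
               d (hbracket (map form (zero_entries ws))))
     else 0)"
proof (cases "nonzero_entries ws = []")
  case True
  then show ?thesis using bracket_zero bracket_Nil by simp
next
  case False
  then obtain us w vs where ws: "ws = us @ w # vs" "nonzero_entries us = []" "fst w \<noteq> 0"
    by (rule first_nonzero_entryE)
  have z: "zero_entries us = us" "nonzero_entries vs = [] \<Longrightarrow> zero_entries vs = vs"
    using ws by (simp_all add: zero_entries_id)
  show ?thesis
    using bracket_split[OF ws(2,3), of vs] ws z by (cases "nonzero_entries vs = []") simp_all
qed

lemma bracket_Cons_degree:
  assumes "q \<noteq> 0" "q \<noteq> 2"
  shows "bracket ((q, y) # vs) = 0"
  using assms by (simp add: bracket_formula)

lemma homogeneous_zero:
  assumes "w \<in> homogeneous \<W>" "fst w = 0"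
  shows "form w \<in> \<H>" "w = (0, 0, form w)"
  using assms by (auto simp: homogeneous_def plectic_space_def)

lemma zero_entries_forms:
  assumes "ws \<in> lists (homogeneous \<W>)"
  shows "set (map form (zero_entries ws)) \<subseteq> \<H>"
  using assms homogeneous_zero(1) by (auto simp: zero_entries_def in_lists_conv_set)

text \<open>
  Exchanging two forms of degree \<open>0\<close> gives the sign of the contraction; exchanging such a form with
  the generator moves the position of the generator by one.
\<close>

lemma bracket_swap:
  assumes "set (us @ x # y # vs) \<subseteq> homogeneous \<W>"
  shows "bracket (us @ y # x # vs) = - bracket (us @ x # y # vs)"
proof -
  consider "fst x = 0" "fst y = 0" | "fst x = 0" "fst y \<noteq> 0" | "fst x \<noteq> 0" "fst y = 0"
    | "fst x \<noteq> 0" "fst y \<noteq> 0" by blast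
  then show ?thesis
  proof cases
    case 1
    let ?f = "\<lambda>x y. map form (zero_entries us) @ form x # form y # map form (zero_entries vs)"
    have H: "set (?f x y) \<subseteq> \<H>"
      using zero_entries_forms[of "us @ x # y # vs"] assms 1 by (simp add: lists_eq_set)
    have s: "hbracket (?f y x) = - hbracket (?f x y)"
      by (rule ham_bracket_swap)
    have "d (hbracket (?f y x)) = - d (hbracket (?f x y))"
      unfolding s by (rule d_uminus[OF ham_bracket_cochain[OF H]])
    then show ?thesis
      using 1 s
      by (cases "nonzero_entries us = []"; cases "nonzero_entries vs = []")
         (simp_all add: bracket_formula zero_entries_id)
  next
    case 4
    then show ?thesis by (simp add: bracket_formula)
  qed (auto simp: bracket_formula)
qed

lemma bracket_permute:
  assumes "ws \<in> lists (homogeneous \<W>)" "\<sigma> permutes {..<length ws}"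
  shows "bracket (permute_entries \<sigma> ws) = of_int (sign \<sigma>) *\<^sub>R bracket ws"
  using sign_equivariant_of_adjacent[of "homogeneous \<W>" bracket \<sigma> "length ws", OF bracket_swap assms(2)] assms(1)
  unfolding sign_equivariant_def lists_eq_set by blast

text \<open>
  The Koszul sign can differ from \<open>1\<close> only where the bracket vanishes.
\<close>

lemma graded_antisymmetric_bracket: "graded_antisymmetric \<W> bracket"
  unfolding graded_antisymmetric_def
proof (intro ballI allI impI)
  fix ws \<sigma> assume ws: "ws \<in> lists (homogeneous \<W>)" and \<sigma>: "\<sigma> permutes {..<length ws}"
  show "bracket (permute_entries \<sigma> ws) = (of_int (sign \<sigma>) * koszul_sign \<sigma> ws) *\<^sub>R bracket ws"
  proof (cases "length (nonzero_entries ws) \<le> 1")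
    case True
    then show ?thesis using bracket_permute[OF ws \<sigma>] koszul_sign_eq_1[OF True \<sigma>] by simp
  next
    case False
    then have "bracket ws = 0" by (auto simp: bracket_formula)
    then show ?thesis using bracket_permute[OF ws \<sigma>] by simp
  qed
qed

text \<open>
  By antisymmetry it is enough to prove multilinearity in the first argument.
\<close>

lemma bracket_Cons_linear:
  assumes vs: "vs \<in> lists (homogeneous \<W>)" and x: "x \<in> \<W> p" and y: "y \<in> \<W> p"
  shows bracket_Cons_add: "bracket ((p, x + y) # vs) = bracket ((p, x) # vs) + bracket ((p, y) # vs)"
    and bracket_Cons_scale: "bracket ((p, c *\<^sub>R x) # vs) = c *\<^sub>R bracket ((p, x) # vs)"
proof -
  let ?zs = "map form (zero_entries vs)"
  note zs = zero_entries_forms[OF vs]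
  consider "p = 0" | "p = 2" | "p \<noteq> 0" "p \<noteq> 2" by blast
  then have "bracket ((p, x + y) # vs) = bracket ((p, x) # vs) + bracket ((p, y) # vs) \<and>
      bracket ((p, c *\<^sub>R x) # vs) = c *\<^sub>R bracket ((p, x) # vs)"
  proof cases
    case 1
    then obtain \<alpha> \<beta> where xy: "x = (0, \<alpha>)" "y = (0, \<beta>)" and h: "\<alpha> \<in> \<H>" "\<beta> \<in> \<H>"
      using x y by (auto simp: plectic_space_def)
    have a: "hbracket ((\<alpha> + \<beta>) # ?zs) = hbracket (\<alpha> # ?zs) + hbracket (\<beta> # ?zs)"
      using ham_bracket_add[of "[]" ?zs] zs h by simp
    have s: "hbracket ((c *\<^sub>R \<alpha>) # ?zs) = c *\<^sub>R hbracket (\<alpha> # ?zs)"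
      using ham_bracket_scale[of "[]" ?zs] zs h by simp
    have coch: "hbracket (\<alpha> # ?zs) \<in> cochains (n - length ?zs)" if "\<alpha> \<in> \<H>" for \<alpha>
      using ham_bracket_cochain[of "\<alpha> # ?zs"] zs that by simp
    have da: "d (hbracket ((\<alpha> + \<beta>) # ?zs)) = d (hbracket (\<alpha> # ?zs)) + d (hbracket (\<beta> # ?zs))"
      unfolding a by (rule d_add[OF coch coch]) (rule h)+
    have ds: "d (hbracket ((c *\<^sub>R \<alpha>) # ?zs)) = c *\<^sub>R d (hbracket (\<alpha> # ?zs))"
      unfolding s by (rule d_scale[OF coch]) (rule h)
    show ?thesis
    proof (cases "nonzero_entries vs = []")
      case True
      then show ?thesis
        using a s by (simp add: bracket_formula xy 1 zero_entries_id)
    next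
      case False
      then show ?thesis
        by (simp add: bracket_formula[of "_ # vs"] xy 1 da ds scaleR_add_right mult.commute mult.left_commute)
    qed
  next
    case 2
    then obtain b c where xy: "x = (b, 0)" "y = (c, 0)"
      using x y by (auto simp: plectic_space_def)
    then show ?thesis
      by (simp add: bracket_formula[of "_ # vs"] 2 scaleR_diff_left scaleR_add_left)
  next
    case 3
    then show ?thesis by (simp add: bracket_Cons_degree)
  qed
  then show "bracket ((p, x + y) # vs) = bracket ((p, x) # vs) + bracket ((p, y) # vs)"
    "bracket ((p, c *\<^sub>R x) # vs) = c *\<^sub>R bracket ((p, x) # vs)" by blast+
qed

lemma bracket_to_front:
  assumes "set (us @ z # vs) \<subseteq> homogeneous \<W>"
  shows "bracket (us @ z # vs) = (-1) ^ length us *\<^sub>R bracket (z # us @ vs)"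
  using assms
proof (induction us arbitrary: vs rule: rev_induct)
  case (snoc u us)
  have "bracket (us @ u # z # vs) = - bracket (us @ z # u # vs)"
    by (rule bracket_swap) (use snoc.prems in auto)
  also have "bracket (us @ z # u # vs) = (-1) ^ length us *\<^sub>R bracket (z # us @ u # vs)"
    by (rule snoc.IH) (use snoc.prems in auto)
  finally show ?case by simp
qed simp

lemma multilinear_bracket: "multilinear_on \<W> bracket"
  unfolding multilinear_on_def
proof (intro ballI allI impI)
  fix ws i p x y c
  assume ws: "ws \<in> lists (homogeneous \<W>)" and i: "i < length ws" and x: "x \<in> \<W> p" and y: "y \<in> \<W> p"
  let ?us = "take i ws" and ?vs = "drop (Suc i) ws"
  have sub: "set ?us \<subseteq> homogeneous \<W>" "set ?vs \<subseteq> homogeneous \<W>"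
    using ws by (auto simp: lists_eq_set dest: in_set_takeD in_set_dropD)
  have uv: "?us @ ?vs \<in> lists (homogeneous \<W>)"
    using sub by (simp add: lists_eq_set)
  have front: "bracket (ws[i := (p, z)]) = (-1) ^ i *\<^sub>R bracket ((p, z) # ?us @ ?vs)" if "z \<in> \<W> p" for z
  proof -
    have "set (?us @ (p, z) # ?vs) \<subseteq> homogeneous \<W>"
      using sub that by (simp add: homogeneous_def)
    from bracket_to_front[OF this] show ?thesis
      using i by (simp add: upd_conv_take_nth_drop)
  qed
  have "bracket (ws[i := (p, x + y)]) = bracket (ws[i := (p, x)]) + bracket (ws[i := (p, y)])"
    unfolding front[OF subspace_add[OF subspace_plectic_space x y]] front[OF x] front[OF y]
      bracket_Cons_add[OF uv x y] scaleR_add_right ..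
  moreover have "bracket (ws[i := (p, c *\<^sub>R x)]) = c *\<^sub>R bracket (ws[i := (p, x)])"
    unfolding front[OF subspace_scale[OF subspace_plectic_space x]] front[OF x]
      bracket_Cons_scale[OF uv x x] by (rule scaleR_left_commute)
  ultimately show "bracket (ws[i := (p, x + y)]) = bracket (ws[i := (p, x)]) + bracket (ws[i := (p, y)]) \<and>
      bracket (ws[i := (p, c *\<^sub>R x)]) = c *\<^sub>R bracket (ws[i := (p, x)])" ..
qed

lemma bracket_degree:
  assumes "ws \<in> lists (homogeneous \<W>)"
  shows "bracket ws \<in> \<W> (total_degree ws + 2 - int (length ws))"
proof (cases "nonzero_entries ws = []")
  case True
  then have t: "total_degree ws = 0"
    by (simp add: total_degree_nonzero_entries[of ws])
  show ?thesis
  proof (cases "ws = []")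
    case True
    then show ?thesis by (simp add: bracket_Nil plectic_space_def)
  next
    case False
    have "(0, hbracket (map form ws)) \<in> \<W> (2 - int (length (map form ws)))"
      by (rule ham_bracket_degree)
         (use zero_entries_forms[OF assms] zero_entries_id[OF True] False in simp_all)
    then show ?thesis using True False t by (simp add: bracket_zero)
  qed
next
  case False
  show ?thesis
  proof (cases "fst (hd (nonzero_entries ws)) = 2 \<and> length (nonzero_entries ws) = 1 \<and> 2 \<le> length (zero_entries ws)")
    case True
    then obtain w where w: "nonzero_entries ws = [w]" "fst w = 2"
      by (auto simp: length_Suc_conv)
    let ?\<alpha>s = "map form (zero_entries ws)"
    have t: "total_degree ws + 2 - int (length ws) = 3 - int (length ?\<alpha>s)"
      using w length_entries[of ws] by (simp add: total_degree_nonzero_entries[of ws])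
    have "r *\<^sub>R (0, d (hbracket ?\<alpha>s)) \<in> \<W> (3 - int (length ?\<alpha>s))" for r
      by (intro subspace_scale[OF subspace_plectic_space] d_ham_bracket_degree zero_entries_forms assms)
    then show ?thesis
      unfolding t bracket_formula[of ws, unfolded if_not_P[OF False] if_P[OF True]]
      by (simp only: scaleR_Pair scaleR_zero_right)
  next
    case c: False
    then have "bracket ws = 0" using False by (simp only: bracket_formula[of ws] if_False)
    then show ?thesis using subspace_0[OF subspace_plectic_space] by simp
  qed
qed

lemma bracket_Cons_zero: "vs \<in> lists (homogeneous \<W>) \<Longrightarrow> bracket ((q, 0) # vs) = 0"
  using bracket_Cons_scale[OF _ subspace_0[OF subspace_plectic_space] subspace_0[OF subspace_plectic_space], of vs q 0]
  by simp

lemma bracket_Cons_closed: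
  assumes vs: "vs \<in> lists (homogeneous \<W>)" and "\<gamma> \<in> \<H>" "d \<gamma> = 0"
  shows "bracket ((0, 0, \<gamma>) # vs) = 0"
proof -
  have "hbracket (\<gamma> # map form (zero_entries vs)) = 0"
    using ham_bracket_closed[of "[]" "map form (zero_entries vs)" \<gamma>] zero_entries_forms[OF vs] assms by simp
  then show ?thesis
    by (cases "nonzero_entries vs = []") (simp_all add: bracket_formula[of "_ # vs"] zero_entries_id zero_prod_def)
qed

section \<open>The Jacobi identities\<close>

text \<open>
  The summand \<open>l\<^sub>j(l\<^sub>i(us), vs)\<close> of the Jacobi identities, without its sign.
\<close>

abbreviation nested :: "(int \<times> real \<times> 'a dform) list \<Rightarrow> (int \<times> real \<times> 'a dform) list \<Rightarrow> real \<times> 'a dform"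
  where "nested us vs \<equiv> bracket ((total_degree us + 2 - int (length us), bracket us) # vs)"

text \<open>
  The inner bracket can only be nonzero if it is the differential of an ordinary bracket of \<open>k \<ge> 2\<close>
  forms, which has degree \<open>3 - k\<close>. The outer bracket vanishes on arguments whose degree is neither
  \<open>0\<close> nor \<open>2\<close>, and for \<open>k = 3\<close> it vanishes because the inner bracket is closed.
\<close>

lemma nested_nonzero_inner:
  assumes us: "us \<in> lists (homogeneous \<W>)" and vs: "vs \<in> lists (homogeneous \<W>)"
    and nz: "nonzero_entries us \<noteq> []"
  shows "nested us vs = 0"
proof (cases "fst (hd (nonzero_entries us)) = 2 \<and> length (nonzero_entries us) = 1 \<and> 2 \<le> length (zero_entries us)")
  case True
  then obtain w where w: "nonzero_entries us = [w]" "fst w = 2"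
    by (auto simp: length_Suc_conv)
  let ?\<alpha>s = "map form (zero_entries us)"
  have t: "total_degree us + 2 - int (length us) = 3 - int (length ?\<alpha>s)"
    using w length_entries[of us] by (simp add: total_degree_nonzero_entries[of us])
  obtain r where r: "bracket us = (0, r *\<^sub>R d (hbracket ?\<alpha>s))"
    using bracket_formula[of us, unfolded if_not_P[OF nz] if_P[OF True]] by (rule that)
  note coch = ham_bracket_cochain[OF zero_entries_forms[OF us]]
  show ?thesis
  proof (cases "length ?\<alpha>s = 3")
    case True
    have "(0, r *\<^sub>R d (hbracket ?\<alpha>s)) \<in> \<W> 0"
      using bracket_degree[OF us] True unfolding r t by simp
    then have "r *\<^sub>R d (hbracket ?\<alpha>s) \<in> \<H>"
      by (simp add: plectic_space_def)
    moreover have "d (r *\<^sub>R d (hbracket ?\<alpha>s)) = 0"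
      unfolding d_scale[OF d_in_cochains[OF coch]] d_d[OF coch] by simp
    ultimately show ?thesis
      unfolding t r True using bracket_Cons_closed[OF vs] by simp
  next
    case False
    then have "3 - int (length ?\<alpha>s) \<noteq> 0" "3 - int (length ?\<alpha>s) \<noteq> 2"
      using \<open>_ \<and> _ \<and> 2 \<le> length (zero_entries us)\<close> by simp_all
    then show ?thesis unfolding t by (rule bracket_Cons_degree)
  qed
next
  case False
  then have "bracket us = 0" using nz by (simp only: bracket_formula[of us] if_False)
  then show ?thesis using bracket_Cons_zero[OF vs] by simp
qed

text \<open>
  For arguments of degree \<open>0\<close> the inner bracket has degree \<open>2 - i\<close>, which is \<open>0\<close> or \<open>2\<close> only for \<open>i = 2\<close> or
  \<open>i = 0\<close>.
\<close>

lemma nested_arity: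
  assumes us: "us \<in> lists (homogeneous \<W>)" and vs: "vs \<in> lists (homogeneous \<W>)"
    and len: "length us \<noteq> 0" "length us \<noteq> 2"
  shows "nested us vs = 0"
proof (cases "nonzero_entries us = []")
  case True
  then have "total_degree us = 0"
    by (simp add: total_degree_nonzero_entries[of us])
  with len show ?thesis by (intro bracket_Cons_degree) auto
qed (rule nested_nonzero_inner[OF us vs])

text \<open>
  If the entries of nonzero degree are not exactly one generator, they make one of the two
  brackets vanish.
\<close>

lemma nested_bad_outer:
  assumes us: "us \<in> lists (homogeneous \<W>)" and vs: "vs \<in> lists (homogeneous \<W>)"
    and "length us = 2"
    and "nonzero_entries (us @ vs) \<noteq> []"
    and "\<not> (length (nonzero_entries (us @ vs)) = 1 \<and> fst (hd (nonzero_entries (us @ vs))) = 2)"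
  shows "nested us vs = 0"
proof (cases "nonzero_entries us = []")
  case True
  then have "total_degree us = 0"
    by (simp add: total_degree_nonzero_entries[of us])
  with assms True show ?thesis
    by (auto simp: bracket_formula[of "_ # vs"])
qed (rule nested_nonzero_inner[OF us vs])

lemma koszul_sign_id: "koszul_sign id ws = 1"
  unfolding koszul_sign_def by (intro prod.neutral ballI) auto

definition pair_term :: "(int \<times> real \<times> 'a dform) list \<Rightarrow> nat \<Rightarrow> nat \<Rightarrow> real \<times> 'a dform" where
  "pair_term ws a b = ((-1) ^ (a + b + 1) * koszul_sign (pair_unshuffle a b) ws) *\<^sub>R
     nested [ws ! a, ws ! b] (omit a (omit b ws))"

lemma lists_permute:
  "ws \<in> lists D \<Longrightarrow> \<sigma> permutes {..<length ws} \<Longrightarrow> permute_entries \<sigma> ws \<in> lists D"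
  unfolding lists_eq_set mem_Collect_eq by (simp only: set_permute_entries)

lemma lists_take_drop: "ws \<in> lists D \<Longrightarrow> take i ws \<in> lists D" "ws \<in> lists D \<Longrightarrow> drop i ws \<in> lists D"
  by (auto simp: in_lists_conv_set dest: in_set_takeD in_set_dropD)

text \<open>
  Only the terms with \<open>i = 0\<close>, for which the identity is the only unshuffle, and \<open>i = 2\<close>, whose unshuffles
  are the pairs of positions, survive in the Jacobi identities.
\<close>

lemma jacobi_sum:
  assumes ws: "ws \<in> lists (homogeneous \<W>)"
  shows "(let m = length ws in
        (\<Sum>i\<le>m. (-1) ^ (i * (m - i)) *\<^sub>R
           (\<Sum>\<sigma>\<in>unshuffles i m. (of_int (sign \<sigma>) * koszul_sign \<sigma> ws) *\<^sub>R
              (let us = take i (permute_entries \<sigma> ws); vs = drop i (permute_entries \<sigma> ws)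
               in bracket ((total_degree us + 2 - int i, bracket us) # vs)))))
    = bracket ((2, bracket []) # ws) + (\<Sum>b<length ws. \<Sum>a<b. pair_term ws a b)"
proof -
  let ?m = "length ws"
  let ?P = "\<lambda>i \<sigma>. (of_int (sign \<sigma>) * koszul_sign \<sigma> ws) *\<^sub>R
              (let us = take i (permute_entries \<sigma> ws); vs = drop i (permute_entries \<sigma> ws)
               in bracket ((total_degree us + 2 - int i, bracket us) # vs))"
  let ?T = "\<lambda>i. (-1) ^ (i * (?m - i)) *\<^sub>R (\<Sum>\<sigma>\<in>unshuffles i ?m. ?P i \<sigma>)"
  have P: "?P i \<sigma> = 0" if "\<sigma> \<in> unshuffles i ?m" "i \<le> ?m" "i \<noteq> 0" "i \<noteq> 2" for i \<sigma>
  proof -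
    have "permute_entries \<sigma> ws \<in> lists (homogeneous \<W>)"
      by (rule lists_permute[OF ws]) (use that in \<open>simp add: unshuffles_def\<close>)
    from nested_arity[OF lists_take_drop[OF this], of i i] that show ?thesis by simp
  qed
  have T: "?T i = 0" if "i \<le> ?m" "i \<noteq> 0" "i \<noteq> 2" for i
  proof -
    have "(\<Sum>\<sigma>\<in>unshuffles i ?m. ?P i \<sigma>) = 0"
      by (intro sum.neutral ballI P that)
    then show ?thesis by (simp only: scaleR_zero_right)
  qed
  have T0: "?T 0 = bracket ((2, bracket []) # ws)"
    unfolding unshuffles_zero by (simp add: koszul_sign_id sign_id del: id_apply)
  have T2: "?T 2 = (\<Sum>b<?m. \<Sum>a<b. pair_term ws a b)" if m: "2 \<le> ?m"
  proof -
    have "?P 2 (pair_unshuffle a b) = pair_term ws a b" if "a < b" "b < ?m" for a b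
      unfolding pair_term_def permute_entries_pair_unshuffle[OF that] sign_pair_unshuffle
      by (simp add: Let_def)
    then show ?thesis
      unfolding sum_unshuffles_two[OF m] by simp
  qed
  have "(\<Sum>i\<le>?m. ?T i) = (\<Sum>i\<in>{0, 2} \<inter> {..?m}. ?T i)"
    by (rule sum.mono_neutral_right) (use T in auto)
  also have "\<dots> = bracket ((2, bracket []) # ws) + (\<Sum>b<?m. \<Sum>a<b. pair_term ws a b)"
  proof (cases "2 \<le> ?m")
    case True
    then have "{0, 2} \<inter> {..?m} = {0, 2}" by auto
    then have "(\<Sum>i\<in>{0, 2} \<inter> {..?m}. ?T i) = ?T 0 + ?T 2"
      by (simp del: mult_0 id_apply)
    then show ?thesis unfolding T0 T2[OF True] .
  next
    case False
    then have "{0, 2} \<inter> {..?m} = {0}" by auto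
    then have "(\<Sum>i\<in>{0, 2} \<inter> {..?m}. ?T i) = ?T 0"
      by (simp only: sum.insert finite.emptyI empty_iff not_False_eq_True sum.empty add_0_right)
    moreover have "(\<Sum>b<?m. \<Sum>a<b. pair_term ws a b) = 0"
      by (rule sum_pairs_neutral[OF False])
    ultimately show ?thesis unfolding T0 by (simp only: add_0_right)
  qed
  finally show ?thesis by (simp only: Let_def)
qed

lemma lists_omit: "ws \<in> lists D \<Longrightarrow> omit i ws \<in> lists D"
  using set_omit_subset[of i ws] by (auto simp: lists_eq_set)

lemma varsigma_0: "varsigma 0 = -1"
  by (simp add: varsigma_def)

text \<open>
  The term with \<open>i = 0\<close> inserts \<open>[1]\<^sub>0 = - \<omega>\<close> and produces the differential of the bracket; it cancels
  the nested binary brackets by the formula for that differential. For fewer than two arguments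
  the bracket with \<open>- \<omega>\<close> is zero by definition, and the sum over pairs is empty.
\<close>

lemma jacobi_zero_degree:
  assumes ws: "ws \<in> lists (homogeneous \<W>)" and nz: "nonzero_entries ws = []"
  shows "bracket ((2, bracket []) # ws) + (\<Sum>b<length ws. \<Sum>a<b. pair_term ws a b) = 0"
proof -
  let ?\<alpha>s = "map form ws"
  have z: "zero_entries ws = ws" by (rule zero_entries_id[OF nz])
  have H: "set ?\<alpha>s \<subseteq> \<H>" using zero_entries_forms[OF ws] z by simp
  have "pair_term ws a b = (0, - ((-1) ^ (a + b) *\<^sub>R
      hbracket (hbracket [?\<alpha>s ! a, ?\<alpha>s ! b] # omit a (omit b ?\<alpha>s))))"
    if ab: "a < b" "b < length ws" for a b
  proof -
    have f: "fst (ws ! a) = 0" "fst (ws ! b) = 0"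
      using nz ab by (auto simp: nonzero_entries_eq_Nil)
    have o: "nonzero_entries (omit a (omit b ws)) = []"
      using nz set_omit2[of a b ws] by (auto simp: nonzero_entries_eq_Nil)
    have k: "koszul_sign (pair_unshuffle a b) ws = 1"
      by (rule koszul_sign_eq_1) (use nz pair_unshuffle_permutes[OF ab] in simp_all)
    show ?thesis
      using ab f o k by (simp add: pair_term_def bracket_zero omit_map)
  qed
  then have "(\<Sum>b<length ws. \<Sum>a<b. pair_term ws a b) = (0, - d (hbracket ?\<alpha>s))"
    unfolding d_ham_bracket[OF H] by (simp add: sum_Pair_zero sum_negf)
  moreover have "bracket ((2, bracket []) # ws) = (0, d (hbracket ?\<alpha>s))"
  proof (cases "2 \<le> length ws")
    case True
    then show ?thesis
      using nz z by (simp add: bracket_formula[of "_ # ws"] bracket_Nil varsigma_0)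
  next
    case False
    have "d (hbracket ?\<alpha>s) = 0"
      unfolding d_ham_bracket[OF H] length_map by (rule sum_pairs_neutral[OF False])
    then show ?thesis
      using False nz z by (simp add: bracket_formula[of "_ # ws"] zero_prod_def)
  qed
  ultimately show ?thesis by (simp add: zero_prod_def)
qed

text \<open>
  With one generator among the arguments, the surviving terms are differentials of the nested
  brackets of the remaining forms. Moving the generator out of the way changes all signs
  alike, so the sum is, up to a common factor, the differential of the differential of the bracket of
  these forms, and vanishes. With two remaining forms the outer bracket would have only one form next
  to the generator and is zero by definition.
\<close>

lemma jacobi_degree_two:
  assumes ws: "ws \<in> lists (homogeneous \<W>)" and nz: "nonzero_entries ws = [w]" and w: "fst w = 2"
  shows "bracket ((2, bracket []) # ws) + (\<Sum>b<length ws. \<Sum>a<b. pair_term ws a b) = 0"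
proof -
  obtain us vs where split: "ws = us @ w # vs" and uv: "nonzero_entries us = []" "nonzero_entries vs = []"
    by (rule nonzero_entries_singleE[OF nz])
  let ?q = "length us" and ?N = "length (us @ vs)" and ?\<alpha>s = "map form (us @ vs)"
  have m: "length ws = Suc ?N" by (simp add: split)
  have uv_hom: "us @ vs \<in> lists (homogeneous \<W>)" using ws by (simp add: split)
  have H: "set ?\<alpha>s \<subseteq> \<H>"
    using zero_entries_forms[OF uv_hom] uv by (simp add: zero_entries_id)
  \<comment> \<open>If the generator enters the inner bracket, the term is zero.\<close>
  have zero: "pair_term ws a b = 0" if "a < b" "b < Suc ?N" "a = ?q \<or> b = ?q" for a b
  proof -
    have "[ws ! a, ws ! b] \<in> lists (homogeneous \<W>)"
      using ws that m by (simp add: in_lists_conv_set)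
    moreover have "ws ! ?q = w" by (simp add: split)
    then have "nonzero_entries [ws ! a, ws ! b] \<noteq> []" using that(3) w by auto
    ultimately have "nested [ws ! a, ws ! b] (omit a (omit b ws)) = 0"
      by (intro nested_nonzero_inner lists_omit ws)
    then show ?thesis unfolding pair_term_def by (simp only: scaleR_zero_right)
  qed
  \<comment> \<open>Otherwise it is a nested bracket of the forms, numbered without the generator.\<close>
  have val: "pair_term ws (skip ?q a) (skip ?q b) =
      (if 3 \<le> ?N then (- fst (snd w) * (-1) ^ ?q) *\<^sub>R (0, (-1) ^ (a + b) *\<^sub>R
        d (hbracket (hbracket [?\<alpha>s ! a, ?\<alpha>s ! b] # omit a (omit b ?\<alpha>s)))) else 0)"
    if ab: "a < b" "b < ?N" for a b
  proof -
    let ?a = "skip ?q a" and ?b = "skip ?q b"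
    have ab': "?a < ?b" "?b < length ws" using ab m by (auto simp: skip_def)
    have nth: "ws ! ?a = (us @ vs) ! a" "ws ! ?b = (us @ vs) ! b"
      using ab nth_skip[of _ us vs w] by (simp_all add: split)
    have "fst u = 0" if "u \<in> set (us @ vs)" for u
      using that uv by (auto simp: nonzero_entries_eq_Nil)
    then have f: "fst (ws ! ?a) = 0" "fst (ws ! ?b) = 0"
      unfolding nth using ab nth_mem[of a "us @ vs"] nth_mem[of b "us @ vs"] by auto
    have in2: "bracket [ws ! ?a, ws ! ?b] = (0, hbracket [?\<alpha>s ! a, ?\<alpha>s ! b])"
      using f ab by (simp add: bracket_zero nth del: map_append)
    obtain us' vs' where o: "omit ?a (omit ?b (us @ w # vs)) = us' @ w # vs'"
      and cat: "us' @ vs' = omit a (omit b (us @ vs))"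
      and sgn: "(-1 :: real) ^ (?a + ?b + length us') = (-1) ^ (a + b + ?q)"
      by (rule omit_two_skipE[OF ab])
    have "set (us' @ vs') \<subseteq> set (us @ vs)" unfolding cat by (rule set_omit2)
    then have nz': "nonzero_entries us' = []" "nonzero_entries vs' = []"
      using uv by (auto simp: nonzero_entries_eq_Nil)
    have len: "length (us' @ vs') = ?N - 2"
      unfolding cat using ab by (simp add: length_omit)
    have forms: "map form (us' @ vs') = omit a (omit b ?\<alpha>s)"
      unfolding cat by (simp only: omit_map)
    let ?h = "hbracket [?\<alpha>s ! a, ?\<alpha>s ! b]"
    have "bracket ((0, 0, ?h) # us' @ w # vs') = (if 3 \<le> ?N
       then (0, (- fst (snd w) * (-1) ^ Suc (length us')) *\<^sub>R d (hbracket (?h # omit a (omit b ?\<alpha>s)))) else 0)"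
      using bracket_split[of "(0, 0, ?h) # us'" w vs'] nz' w len ab forms by auto
    moreover have "koszul_sign (pair_unshuffle ?a ?b) ws = 1"
      by (rule koszul_sign_eq_1) (use nz pair_unshuffle_permutes[OF ab'] in simp_all)
    moreover have "(-1) ^ (?a + ?b + 1) * (- fst (snd w) * (-1) ^ Suc (length us'))
        = - fst (snd w) * (-1) ^ ?q * (-1) ^ (a + b)"
    proof -
      have "(-1) ^ (?a + ?b + 1) * (- fst (snd w) * (-1) ^ Suc (length us'))
          = - fst (snd w) * (-1) ^ (?a + ?b + length us')"
        by (simp add: power_add)
      then show ?thesis unfolding sgn by (simp add: power_add ac_simps)
    qed
    moreover have "omit ?a (omit ?b ws) = us' @ w # vs'"
      unfolding split by (rule o)
    moreover have "total_degree [ws ! ?a, ws ! ?b] + 2 - int (length [ws ! ?a, ws ! ?b]) = 0"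
      using f by simp
    ultimately show ?thesis
      unfolding pair_term_def in2
      by (cases "3 \<le> ?N")
         (simp_all only: if_True if_False mult_1_right scaleR_Pair scaleR_zero_right scaleR_scaleR)
  qed
  have "(\<Sum>b<length ws. \<Sum>a<b. pair_term ws a b) = (\<Sum>b<?N. \<Sum>a<b. pair_term ws (skip ?q a) (skip ?q b))"
    unfolding m by (rule sum_pairs_skip) (use zero in auto)
  also have "\<dots> = 0"
  proof (cases "3 \<le> ?N")
    case True
    let ?B = "\<lambda>a b. hbracket (hbracket [?\<alpha>s ! a, ?\<alpha>s ! b] # omit a (omit b ?\<alpha>s))"
    have coch: "?B a b \<in> cochains (n + 1 - (?N - 1))" if "a < b" "b < ?N" for a b
    proof -
      have h: "?\<alpha>s ! a \<in> \<H>" "?\<alpha>s ! b \<in> \<H>"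
        by (rule subsetD[OF H nth_mem]; use that in simp)+
      have "set (hbracket [?\<alpha>s ! a, ?\<alpha>s ! b] # omit a (omit b ?\<alpha>s)) \<subseteq> \<H>"
        using order_trans[OF set_omit2 H] ham_bracket_pair(1)[OF h some_ham_vf[OF h(1)] some_ham_vf[OF h(2)]]
        by simp
      from ham_bracket_cochain[OF this] that show ?thesis by (simp add: length_omit Suc_diff_Suc)
    qed
    have "(\<Sum>b<?N. \<Sum>a<b. (-1) ^ (a + b) *\<^sub>R d (?B a b)) = (\<Sum>b<?N. \<Sum>a<b. d ((-1) ^ (a + b) *\<^sub>R ?B a b))"
      by (rule sum.cong[OF refl], rule sum.cong[OF refl], rule d_scale[symmetric], rule coch) auto
    also have "\<dots> = (\<Sum>b<?N. d (\<Sum>a<b. (-1) ^ (a + b) *\<^sub>R ?B a b))"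
      by (rule sum.cong[OF refl], rule d_sum[symmetric], rule cochains_closed(4)[OF coch]) auto
    also have "\<dots> = d (\<Sum>b<?N. \<Sum>a<b. (-1) ^ (a + b) *\<^sub>R ?B a b)"
      by (rule d_sum[symmetric], rule cochains_closed(5), rule cochains_closed(4)[OF coch]) auto
    also have "\<dots> = d (d (hbracket ?\<alpha>s))"
      unfolding d_ham_bracket[OF H] length_map ..
    finally have dd: "(\<Sum>b<?N. \<Sum>a<b. (-1) ^ (a + b) *\<^sub>R d (?B a b)) = 0"
      unfolding d_d_ham_bracket[OF H] .
    have "(\<Sum>b<?N. \<Sum>a<b. pair_term ws (skip ?q a) (skip ?q b)) =
        (\<Sum>b<?N. \<Sum>a<b. (- fst (snd w) * (-1) ^ ?q) *\<^sub>R (0, (-1) ^ (a + b) *\<^sub>R d (?B a b)))"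
      by (intro sum.cong refl) (use val True in auto)
    also have "\<dots> = (- fst (snd w) * (-1) ^ ?q) *\<^sub>R (0, \<Sum>b<?N. \<Sum>a<b. (-1) ^ (a + b) *\<^sub>R d (?B a b))"
      unfolding scaleR_sum_right[symmetric] sum_Pair_zero ..
    finally show ?thesis unfolding dd by (simp add: zero_prod_def)
  next
    case False
    show ?thesis
      by (intro sum.neutral ballI) (use val False in auto)
  qed
  finally have "(\<Sum>b<length ws. \<Sum>a<b. pair_term ws a b) = 0" .
  moreover have "bracket ((2, bracket []) # ws) = 0"
    using nz by (simp add: bracket_formula[of "_ # ws"])
  ultimately show ?thesis by simp
qed

lemma jacobi_other:
  assumes ws: "ws \<in> lists (homogeneous \<W>)" and nz: "nonzero_entries ws \<noteq> []"
    and bad: "\<not> (length (nonzero_entries ws) = 1 \<and> fst (hd (nonzero_entries ws)) = 2)"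
  shows "bracket ((2, bracket []) # ws) + (\<Sum>b<length ws. \<Sum>a<b. pair_term ws a b) = 0"
proof -
  have "pair_term ws a b = 0" if ab: "a < b" "b < length ws" for a b
  proof -
    let ?us = "[ws ! a, ws ! b]" and ?vs = "omit a (omit b ws)"
    have "mset (?us @ ?vs) = mset ws"
      using mset_permute_entries[OF pair_unshuffle_permutes[OF ab]] permute_entries_pair_unshuffle[OF ab] by simp
    then have ms: "mset (nonzero_entries (?us @ ?vs)) = mset (nonzero_entries ws)"
      by (rule mset_nonzero_entries)
    then have len: "length (nonzero_entries (?us @ ?vs)) = length (nonzero_entries ws)"
      by (rule mset_eq_length)
    have "nested ?us ?vs = 0"
    proof (rule nested_bad_outer)
      show "?us \<in> lists (homogeneous \<W>)" using ws ab by (simp add: in_lists_conv_set)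
      show "?vs \<in> lists (homogeneous \<W>)" by (intro lists_omit ws)
      show "length ?us = 2" by simp
      show "nonzero_entries (?us @ ?vs) \<noteq> []" using len nz by (simp only: length_0_conv[symmetric] simp_thms)
      show "\<not> (length (nonzero_entries (?us @ ?vs)) = 1 \<and> fst (hd (nonzero_entries (?us @ ?vs))) = 2)"
      proof
        assume *: "length (nonzero_entries (?us @ ?vs)) = 1 \<and> fst (hd (nonzero_entries (?us @ ?vs))) = 2"
        then have "nonzero_entries (?us @ ?vs) = nonzero_entries ws"
          using mset_eq_singleton_list[OF ms] by blast
        with * bad show False by (simp only: simp_thms)
      qed
    qed
    then show ?thesis unfolding pair_term_def by (simp only: scaleR_zero_right)
  qed
  moreover have "bracket ((2, bracket []) # ws) = 0"
    using nz by (simp add: bracket_formula[of "_ # ws"])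
  ultimately show ?thesis by simp
qed

lemma curved_jacobi_bracket: "curved_jacobi \<W> bracket"
  unfolding curved_jacobi_def
proof (intro ballI)
  fix ws assume ws: "ws \<in> lists (homogeneous \<W>)"
  have "bracket ((2, bracket []) # ws) + (\<Sum>b<length ws. \<Sum>a<b. pair_term ws a b) = 0"
  proof (cases "nonzero_entries ws = []")
    case True
    then show ?thesis by (rule jacobi_zero_degree[OF ws])
  next
    case nz: False
    show ?thesis
    proof (cases "length (nonzero_entries ws) = 1 \<and> fst (hd (nonzero_entries ws)) = 2")
      case True
      then obtain w where "nonzero_entries ws = [w]" "fst w = 2" by (auto simp: length_Suc_conv)
      then show ?thesis by (rule jacobi_degree_two[OF ws])
    qed (rule jacobi_other[OF ws nz])
  qed
  then show "let m = length ws in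
        (\<Sum>i\<le>m. (-1) ^ (i * (m - i)) *\<^sub>R
           (\<Sum>\<sigma>\<in>unshuffles i m. (of_int (sign \<sigma>) * koszul_sign \<sigma> ws) *\<^sub>R
              (let us = take i (permute_entries \<sigma> ws); vs = drop i (permute_entries \<sigma> ws)
               in bracket ((total_degree us + 2 - int i, bracket us) # vs)))) = 0"
    using jacobi_sum[OF ws] by (simp only: Let_def)
qed

lemma curved_L_infinity_bracket: "curved_L_infinity \<W> bracket"
  unfolding curved_L_infinity_def
  using subspace_plectic_space bracket_degree multilinear_bracket graded_antisymmetric_bracket curved_jacobi_bracket
  by blast

end

theorem proposition5p3:
  fixes M :: "'a::{t2_space, second_countable_topology} manifold"
    and n :: nat
    and \<omega> :: "'a dform"
  assumes "smooth_manifold M"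
    and "n \<ge> 1"
    and "pre_plectic M n \<omega>"
  shows "(\<forall>\<alpha>s vs. set \<alpha>s \<subseteq> ham_forms M n \<omega> \<and> list_all2 (ham_vector_field M \<omega>) \<alpha>s vs \<longrightarrow>
            ham_bracket M \<omega> \<alpha>s = varsigma (length \<alpha>s) *\<^sub>R contraction vs \<omega>) \<and>
         curved_L_infinity (plectic_space M n \<omega>) (plectic_bracket M \<omega>)"
proof -
  interpret pre_plectic_mfd M n \<omega>
    using assms by unfold_locales
  show ?thesis
    using ham_bracket_eq curved_L_infinity_bracket by blast
qed

end
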